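(* The algebra $\mathrm{U}(W_+)$ satisfies the ascending chain condition on two-sided ideals whose associated graded ideals are radical: if $J_1\subseteq J_2\subseteq\cdots$ is an ascending chain of two-sided ideals of $\mathrm{U}(W_+)$ such that each $\operatorname{gr}_o(J_i)$ is a radical ideal of $\mathrm{S}(W_+)$, then $J_i=J_{i+1}$ for all $i\gg0$.
   Context: $\Bbbk$ is a field of characteristic zero. The positive Witt algebra $W_+$ is the Lie algebra over $\Bbbk$ with basis $\{e_n : n\in\mathbb{Z}_{\geq 1}\}$ and bracket $[e_i,e_j]=(j-i)e_{i+j}$; $\mathrm{U}(W_+)$ is its universal enveloping algebra and $\mathrm{S}(W_+)$ its symmetric algebra. The order filtration $o$ on $\mathrm{U}(W_+)$ is the standard filtration with each $e_i$ of order $1$; its associated graded ring is $\mathrm{S}(W_+)$. For an ideal $J$ of $\mathrm{U}(W_+)$, $\operatorname{gr}_o(J)\subseteq\mathrm{S}(W_+)$ is the associated graded ideal with respect to the order filtration, i.e. the ideal spanned by the leading symbols (with respect to $o$) of elements of $J$. *)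

theory Defs
  imports
    "HOL-Library.Poly_Mapping"
    "HOL-Algebra.QuotRing"
    "HOL-Algebra.Algebraic_Closure_Type"
begin

text \<open>
  The basis \<open>e\<^sub>n\<close> (\<open>n \<ge> 1\<close>) is indexed by the type \<^typ>\<open>num\<close>, which is exactly the type of positive
  integers; \<^term>\<open>numeral n :: 'k::field_char_0\<close> is the image of \<open>n\<close> in the base field \<open>'k\<close>.
\<close>

type_synonym 'k witt = "num \<Rightarrow>\<^sub>0 'k"

definition witt_bracket :: "'k::field_char_0 witt \<Rightarrow> 'k witt \<Rightarrow> 'k witt" where
  "witt_bracket x y =
     (\<Sum>i\<in>Poly_Mapping.keys x. \<Sum>j\<in>Poly_Mapping.keys y.
        Poly_Mapping.single (i + j)
          (Poly_Mapping.lookup x i * Poly_Mapping.lookup y j * (numeral j - numeral i)))"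

lemma witt_bracket_basis:
  "witt_bracket (Poly_Mapping.single i 1) (Poly_Mapping.single j (1 :: 'k::field_char_0)) =
     Poly_Mapping.single (i + j) (numeral j - numeral i)"
  by (simp add: witt_bracket_def)

subsection \<open>Tensor algebra and symmetric algebra\<close>

text \<open>
  The free monoid, written additively so that \<open>'i word \<Rightarrow>\<^sub>0 'k\<close> carries the convolution
  product of \<open>Poly_Mapping\<close>, i.e. is the free associative algebra on \<open>'i\<close>.
\<close>

datatype 'i word = Word (letters: "'i list")

instantiation word :: (type) monoid_add
begin

definition zero_word :: "'i word" where "zero_word = Word []"

definition plus_word :: "'i word \<Rightarrow> 'i word \<Rightarrow> 'i word" where
  "plus_word v w = Word (letters v @ letters w)"

instance
  by standard (simp_all add: zero_word_def plus_word_def)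

end

text \<open>The tensor algebra and the symmetric algebra of \<open>W\<^sub>+\<close>, in terms of its basis.\<close>

type_synonym 'k witt_tensor = "num word \<Rightarrow>\<^sub>0 'k"
type_synonym 'k witt_sym = "(num \<Rightarrow>\<^sub>0 nat) \<Rightarrow>\<^sub>0 'k"

definition T_W :: "'k::field_char_0 witt_tensor ring" where
  "T_W = ring_of_type_algebra"

definition S_W :: "'k::field_char_0 witt_sym ring" where
  "S_W = ring_of_type_algebra"

lemma ring_T_W: "ring (T_W :: 'k::field_char_0 witt_tensor ring)"
proof -
  have "\<exists>y. x + y = 0" for x :: "'k witt_tensor"
    by (rule exI[of _ "- x"]) simp
  then show ?thesis
    unfolding T_W_def ring_of_type_algebra_def
    by unfold_locales (auto simp: algebra_simps Units_def add_eq_0_iff)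
qed

lemma cring_S_W: "cring (S_W :: 'k::field_char_0 witt_sym ring)"
  unfolding S_W_def by (rule cring_from_type_algebra)

definition tensor_of :: "'k::field_char_0 witt \<Rightarrow> 'k witt_tensor" where
  "tensor_of x = (\<Sum>i\<in>Poly_Mapping.keys x. Poly_Mapping.single (Word [i]) (Poly_Mapping.lookup x i))"

subsection \<open>The universal enveloping algebra and its order filtration\<close>

definition U_rel :: "'k::field_char_0 witt_tensor set" where
  "U_rel = Idl\<^bsub>T_W\<^esub>
     {tensor_of x * tensor_of y - tensor_of y * tensor_of x - tensor_of (witt_bracket x y) | x y. True}"

definition U_W :: "'k::field_char_0 witt_tensor set ring" where
  "U_W = T_W Quot U_rel"

definition U_class :: "'k::field_char_0 witt_tensor \<Rightarrow> 'k witt_tensor set" where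
  "U_class t = U_rel +>\<^bsub>T_W\<^esub> t"

lemma ideal_U_rel: "ideal U_rel (T_W :: 'k::field_char_0 witt_tensor ring)"
  unfolding U_rel_def
  by (rule ring.genideal_ideal[OF ring_T_W]) (simp add: T_W_def ring_of_type_algebra_def)

lemma ring_U_W: "ring (U_W :: 'k::field_char_0 witt_tensor set ring)"
  unfolding U_W_def by (rule ideal.quotient_is_ring[OF ideal_U_rel])

definition tensor_filtration :: "nat \<Rightarrow> 'k::field_char_0 witt_tensor set" where
  "tensor_filtration n = {t. \<forall>w\<in>Poly_Mapping.keys t. length (letters w) \<le> n}"

definition order_filtration :: "nat \<Rightarrow> 'k::field_char_0 witt_tensor set set" where
  "order_filtration n = U_class ` tensor_filtration n"

definition U_order :: "'k::field_char_0 witt_tensor set \<Rightarrow> nat" where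
  "U_order u = (LEAST n. u \<in> order_filtration n)"

subsection \<open>Leading symbols and associated graded ideals\<close>

text \<open>
  The image of the degree \<open>n\<close> component of \<open>t\<close> under the canonical map from the tensor algebra to the
  symmetric algebra; a word maps to the commutative monomial with the same letters.
\<close>

definition sym_component :: "nat \<Rightarrow> 'k::field_char_0 witt_tensor \<Rightarrow> 'k witt_sym" where
  "sym_component n t =
     (\<Sum>w\<in>{w \<in> Poly_Mapping.keys t. length (letters w) = n}.
        Poly_Mapping.single (\<Sum>i\<leftarrow>letters w. Poly_Mapping.single i 1) (Poly_Mapping.lookup t w))"

text \<open>
  \<open>s\<close> is the leading symbol of \<open>u \<noteq> 0\<close>: the class of \<open>u\<close> in \<open>U\<^sub>\<le>\<^sub>n / U\<^sub><\<^sub>n\<close> (\<open>n\<close> the order of \<open>u\<close>),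
  identified with an element of \<open>S\<^sup>n\<close> by the Poincare-Birkhoff-Witt isomorphism, which matches
  the class of \<open>x\<^sub>1 \<cdots> x\<^sub>n\<close> with the commutative monomial \<open>x\<^sub>1 \<cdots> x\<^sub>n\<close>.  By that
  theorem \<open>s\<close> does not depend on the choice of the representative \<open>t\<close>.
\<close>

definition leading_symbol :: "'k::field_char_0 witt_tensor set \<Rightarrow> 'k witt_sym \<Rightarrow> bool" where
  "leading_symbol u s \<longleftrightarrow>
     u \<noteq> \<zero>\<^bsub>U_W\<^esub> \<and>
     (\<exists>t\<in>tensor_filtration (U_order u). u = U_class t \<and> s = sym_component (U_order u) t)"

definition gr_o :: "'k::field_char_0 witt_tensor set set \<Rightarrow> 'k witt_sym set" where
  "gr_o J = Idl\<^bsub>S_W\<^esub> {s. \<exists>u\<in>J. leading_symbol u s}"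

definition ideal_radical :: "('a, 'b) ring_scheme \<Rightarrow> 'a set \<Rightarrow> 'a set" where
  "ideal_radical R I = {x \<in> carrier R. \<exists>n::nat. n > 0 \<and> x [^]\<^bsub>R\<^esub> n \<in> I}"

definition radical_ideal :: "'a set \<Rightarrow> ('a, 'b) ring_scheme \<Rightarrow> bool" where
  "radical_ideal I R \<longleftrightarrow> ideal I R \<and> ideal_radical R I = I"

end

theory Submission
  imports Defs
begin

text \<open>
  Up to scalars, \<open>ad e\<^sub>1\<close> sends \<open>e\<^sub>n\<close> to \<open>e\<^sub>n\<^sub>+\<^sub>1\<close> for \<open>n \<ge> 2\<close> and kills \<open>e\<^sub>1\<close>.  So \<open>S(W\<^sub>+)\<close> with the derivation
  \<open>ad e\<^sub>1\<close> is the ring of differential polynomials in the single indeterminate \<open>e\<^sub>2\<close> over the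
  constants \<open>k[e\<^sub>1]\<close>, and the Ritt--Raudenbush basis theorem gives the ascending chain condition for its
  radical differential ideals.  The proof is the classical one: a maximal radical differential ideal \<open>P\<close>
  without finite basis is prime; for \<open>f \<in> P\<close> of minimal rank whose initial \<open>i\<close> is not in \<open>P\<close>, the separant
  \<open>s\<close> is not in \<open>P\<close> either, while reduction modulo the derivatives of \<open>f\<close> puts \<open>i s P\<close> into a finitely
  generated radical differential ideal inside \<open>P\<close>, and this is impossible.

  For a two-sided ideal \<open>J\<close> of \<open>U(W\<^sub>+)\<close> the ideal \<open>gr J\<close> is stable under \<open>ad e\<^sub>1\<close>, because the symbol of
  \<open>e\<^sub>1 u - u e\<^sub>1\<close> is \<open>ad e\<^sub>1\<close> of the symbol of \<open>u\<close>.  Hence \<open>gr J\<^sub>i\<close> is eventually constant, and \<open>J \<subseteq> J'\<close> with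
  \<open>gr J = gr J'\<close> forces \<open>J = J'\<close> by induction on the order.
\<close>

subsection \<open>Radical differential ideals\<close>

locale derivation =
  fixes \<delta> :: "'a::comm_ring_1 \<Rightarrow> 'a"
  assumes deriv_add: "\<delta> (x + y) = \<delta> x + \<delta> y"
    and deriv_mult: "\<delta> (x * y) = \<delta> x * y + x * \<delta> y"
begin

lemma deriv_zero [simp]: "\<delta> 0 = 0"
  using deriv_add[of 0 0] by simp

lemma deriv_one [simp]: "\<delta> 1 = 0"
  using deriv_mult[of 1 1] by simp

text \<open>Radicality is imposed for squares only, which keeps closure proofs short;
  \<open>rdi_power\<close> recovers all exponents.\<close>

definition rdi :: "'a set \<Rightarrow> bool" where
  "rdi I \<longleftrightarrow> 0 \<in> I \<and> (\<forall>x\<in>I. \<forall>y\<in>I. x + y \<in> I) \<and> (\<forall>a. \<forall>x\<in>I. a * x \<in> I) \<and>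
     (\<forall>x\<in>I. \<delta> x \<in> I) \<and> (\<forall>x. x * x \<in> I \<longrightarrow> x \<in> I)"

lemma rdiI:
  assumes "0 \<in> I" "\<And>x y. x \<in> I \<Longrightarrow> y \<in> I \<Longrightarrow> x + y \<in> I" "\<And>a x. x \<in> I \<Longrightarrow> a * x \<in> I"
    "\<And>x. x \<in> I \<Longrightarrow> \<delta> x \<in> I" "\<And>x. x * x \<in> I \<Longrightarrow> x \<in> I"
  shows "rdi I"
  using assms unfolding rdi_def by blast

lemma
  assumes "rdi I"
  shows rdi_zero: "0 \<in> I"
    and rdi_add: "x \<in> I \<Longrightarrow> y \<in> I \<Longrightarrow> x + y \<in> I"
    and rdi_mult: "x \<in> I \<Longrightarrow> a * x \<in> I"
    and rdi_deriv: "x \<in> I \<Longrightarrow> \<delta> x \<in> I"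
    and rdi_square: "x * x \<in> I \<Longrightarrow> x \<in> I"
  using assms unfolding rdi_def by blast+

lemma rdi_uminus: "rdi I \<Longrightarrow> x \<in> I \<Longrightarrow> - x \<in> I"
  using rdi_mult[of I x "-1"] by simp

lemma rdi_diff: "rdi I \<Longrightarrow> x \<in> I \<Longrightarrow> y \<in> I \<Longrightarrow> x - y \<in> I"
  using rdi_add[of I x "- y"] rdi_uminus[of I y] by simp

text \<open>For \<open>n > 1\<close> let \<open>m\<close> be half of \<open>n\<close>, rounded up.
  Then \<open>m < n\<close>, and the square of \<open>x ^ m\<close> is a multiple of
  \<open>x ^ n\<close>, so the exponent descends. For \<open>n = 0\<close> the hypothesis puts 1,
  hence everything, into \<open>I\<close>.\<close>

lemma rdi_power: "rdi I \<Longrightarrow> x ^ n \<in> I \<Longrightarrow> x \<in> I"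
proof (induction n rule: less_induct)
  case (less n)
  show ?case
  proof (cases "n \<le> 1")
    case True
    then show ?thesis
      using less.prems rdi_mult[of I 1 x] by (cases n) auto
  next
    case False
    define m where "m = (n + 1) div 2"
    have m: "m < n" "m + m = n + (m + m - n)"
      using False by (auto simp: m_def)
    have "x ^ m * x ^ m = x ^ (m + m - n) * x ^ n"
      by (metis m(2) power_add mult.commute)
    then have "x ^ m * x ^ m \<in> I"
      using less.prems rdi_mult by simp
    then have "x ^ m \<in> I"
      using less.prems rdi_square by blast
    then show ?thesis
      using less.IH m less.prems by blast
  qed
qed

text \<open>Multiplying \<delta>(ab) by a\<delta>(b) and removing a multiple of ab leaves the square
  of a\<delta>(b).\<close>

lemma rdi_mult_deriv:
  assumes I: "rdi I" and "a * b \<in> I"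
  shows "a * \<delta> b \<in> I"
proof -
  have "\<delta> a * b + a * \<delta> b \<in> I"
    using rdi_deriv[OF I assms(2)] by (simp add: deriv_mult)
  then have "(a * \<delta> b) * (\<delta> a * b + a * \<delta> b) - (\<delta> a * \<delta> b) * (a * b) \<in> I"
    by (rule rdi_diff[OF I rdi_mult[OF I] rdi_mult[OF I assms(2)]])
  then have "(a * \<delta> b) * (a * \<delta> b) \<in> I"
    by (simp add: algebra_simps)
  then show ?thesis
    using I rdi_square by blast
qed

text \<open>Colon ideals are what makes \<open>rdgen\<close> manageable: to multiply all of
  \<open>rdgen S\<close> into \<open>I\<close> it is enough to multiply \<open>S\<close> into
  \<open>I\<close> (\<open>mult_rdgen\<close>), without an explicit description of the elements of
  \<open>rdgen S\<close>.\<close>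

lemma rdi_colon:
  assumes I: "rdi I"
  shows "rdi {x. a * x \<in> I}"
proof (rule rdiI)
  fix x assume "x * x \<in> {x. a * x \<in> I}"
  then have "a * (a * (x * x)) \<in> I"
    using rdi_mult[OF I, of "a * (x * x)" a] by simp
  then have "(a * x) * (a * x) \<in> I"
    by (simp add: algebra_simps)
  then show "x \<in> {x. a * x \<in> I}"
    using rdi_square[OF I, of "a * x"] by simp
next
  fix b x assume "x \<in> {x. a * x \<in> I}"
  then have "b * (a * x) \<in> I"
    using rdi_mult[OF I, of "a * x" b] by simp
  then show "b * x \<in> {x. a * x \<in> I}"
    by (simp add: algebra_simps)
qed (simp_all add: distrib_left rdi_zero[OF I] rdi_add[OF I] rdi_mult_deriv[OF I])

definition rdgen :: "'a set \<Rightarrow> 'a set" where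
  "rdgen S = \<Inter>{I. rdi I \<and> S \<subseteq> I}"

lemma rdi_rdgen: "rdi (rdgen S)"
  unfolding rdgen_def
  by (rule rdiI; clarsimp; (rule rdi_zero rdi_add rdi_mult rdi_deriv rdi_square; blast))

lemma rdgen_superset: "S \<subseteq> rdgen S"
  unfolding rdgen_def by blast

lemma rdgen_least: "rdi I \<Longrightarrow> S \<subseteq> I \<Longrightarrow> rdgen S \<subseteq> I"
  unfolding rdgen_def by blast

lemma rdgen_mono: "S \<subseteq> T \<Longrightarrow> rdgen S \<subseteq> rdgen T"
  unfolding rdgen_def by blast

lemma mult_rdgen:
  assumes "rdi I" "\<And>y. y \<in> S \<Longrightarrow> a * y \<in> I" "x \<in> rdgen S"
  shows "a * x \<in> I"
  using rdgen_least[OF rdi_colon[OF assms(1)], of S a] assms(2,3) by blast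

text \<open>The elements that finitely many members of \<open>S\<close> account for already form a
  radical differential ideal containing \<open>S\<close>.\<close>

lemma rdgen_finitary:
  assumes "x \<in> rdgen S"
  shows "\<exists>F. finite F \<and> F \<subseteq> S \<and> x \<in> rdgen F"
proof -
  let ?I = "{x. \<exists>F. finite F \<and> F \<subseteq> S \<and> x \<in> rdgen F}"
  have "rdi ?I"
  proof (rule rdiI)
    show "0 \<in> ?I"
      by (intro CollectI exI[of _ "{}"]) (simp add: rdi_zero[OF rdi_rdgen])
  next
    fix x y assume "x \<in> ?I" "y \<in> ?I"
    then obtain F G where "finite F" "F \<subseteq> S" "x \<in> rdgen F" "finite G" "G \<subseteq> S" "y \<in> rdgen G"
      by blast
    then show "x + y \<in> ?I"
      using rdgen_mono[of F "F \<union> G"] rdgen_mono[of G "F \<union> G"]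
      by (intro CollectI exI[of _ "F \<union> G"]) (auto intro: rdi_add[OF rdi_rdgen])
  qed (clarsimp; blast intro: rdi_mult[OF rdi_rdgen] rdi_deriv[OF rdi_rdgen] dest: rdi_square[OF rdi_rdgen])+
  moreover have "S \<subseteq> ?I"
  proof
    fix x assume "x \<in> S"
    then show "x \<in> ?I"
      using rdgen_superset[of "{x}"] by (intro CollectI exI[of _ "{x}"]) simp
  qed
  ultimately show ?thesis
    using rdgen_least assms by blast
qed

lemma rdgen_finitary_set:
  assumes "finite G" "G \<subseteq> rdgen S"
  shows "\<exists>F. finite F \<and> F \<subseteq> S \<and> G \<subseteq> rdgen F"
  using assms
proof (induction G rule: finite_induct)
  case empty
  then show ?case by blast
next
  case (insert g G)
  then obtain F F' where F: "finite F" "F \<subseteq> S" "G \<subseteq> rdgen F" "finite F'" "F' \<subseteq> S" "g \<in> rdgen F'"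
    using rdgen_finitary[of g S] by auto
  then show ?case
    using rdgen_mono[of F "F \<union> F'"] rdgen_mono[of F' "F \<union> F'"]
    by (intro exI[of _ "F \<union> F'"]) auto
qed

section \<open>Finite bases, chains and Zorn's lemma\<close>

definition rdi_fg :: "'a set \<Rightarrow> bool" where
  "rdi_fg I \<longleftrightarrow> (\<exists>F. finite F \<and> F \<subseteq> I \<and> I \<subseteq> rdgen F)"

lemma rdi_Union_chain:
  assumes "C \<noteq> {}" "subset.chain {I. rdi I} C"
  shows "rdi (\<Union>C)"
proof -
  have C: "\<And>I. I \<in> C \<Longrightarrow> rdi I" "\<And>I J. I \<in> C \<Longrightarrow> J \<in> C \<Longrightarrow> I \<subseteq> J \<or> J \<subseteq> I"
    using assms(2) by (auto simp: subset_chain_def)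
  show ?thesis
  proof (rule rdiI)
    fix x y assume "x \<in> \<Union>C" "y \<in> \<Union>C"
    then obtain I where "I \<in> C" "x \<in> I" "y \<in> I"
      using C(2) by blast
    then show "x + y \<in> \<Union>C"
      using C(1) rdi_add by blast
  qed (use assms(1) in \<open>blast intro: rdi_zero rdi_mult rdi_deriv dest: C(1) rdi_square\<close>)+
qed

text \<open>Zorn's lemma applies because a finite basis of the union of a chain lies in one member
  of the chain and would be a finite basis of that member.\<close>

lemma rdi_maximal_not_fg:
  assumes "rdi I" "\<not> rdi_fg I"
  shows "\<exists>P. rdi P \<and> \<not> rdi_fg P \<and> (\<forall>Q. rdi Q \<and> P \<subset> Q \<longrightarrow> rdi_fg Q)"
proof -
  let ?A = "{I. rdi I \<and> \<not> rdi_fg I}"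
  have "\<Union>C \<in> ?A" if C: "C \<noteq> {}" "subset.chain ?A C" for C
  proof -
    have rdi: "rdi (\<Union>C)"
      using C(2) by (intro rdi_Union_chain C(1)) (auto simp: subset_chain_def)
    have "\<not> rdi_fg (\<Union>C)"
    proof
      assume "rdi_fg (\<Union>C)"
      then obtain F where F: "finite F" "F \<subseteq> \<Union>C" "\<Union>C \<subseteq> rdgen F"
        unfolding rdi_fg_def by blast
      then obtain J where "J \<in> C" "F \<subseteq> J"
        using finite_subset_Union_chain[OF F(1,2) C] by blast
      moreover have "\<not> rdi_fg J"
        using \<open>J \<in> C\<close> C(2) by (auto simp: subset_chain_def)
      ultimately show False
        using F unfolding rdi_fg_def by blast
    qed
    with rdi show ?thesis by blast
  qed
  then have "\<exists>P\<in>?A. \<forall>S\<in>?A. P \<subseteq> S \<longrightarrow> S = P"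
    using assms by (intro subset_Zorn_nonempty[of ?A]) auto
  then obtain P where "P \<in> ?A" "\<And>S. S \<in> ?A \<Longrightarrow> P \<subseteq> S \<Longrightarrow> S = P"
    by blast
  then show ?thesis
    by (intro exI[of _ P]) blast
qed

theorem rdi_ascending_chain:
  fixes J :: "nat \<Rightarrow> 'a set"
  assumes fg: "\<And>I. rdi I \<Longrightarrow> rdi_fg I" and J: "\<And>i. rdi (J i)" and inc: "\<And>i. J i \<subseteq> J (Suc i)"
  shows "\<exists>N. \<forall>i\<ge>N. J i = J (Suc i)"
proof -
  have mono: "i \<le> j \<Longrightarrow> J i \<subseteq> J j" for i j
    by (rule lift_Suc_mono_le[of J, OF inc])
  have "J i \<subseteq> J j \<or> J j \<subseteq> J i" for i j
    using mono[of i j] mono[of j i] by linarith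
  then have chain: "subset.chain (range J) (range J)"
    unfolding subset_chain_def by blast
  have "rdi (\<Union>(range J))"
    using chain J by (intro rdi_Union_chain) (auto simp: subset_chain_def)
  then obtain F where F: "finite F" "F \<subseteq> \<Union>(range J)" "\<Union>(range J) \<subseteq> rdgen F"
    using fg unfolding rdi_fg_def by meson
  then obtain N where "F \<subseteq> J N"
    using finite_subset_Union_chain[OF F(1,2) _ chain] by blast
  then have "\<Union>(range J) \<subseteq> J N"
    using F(3) rdgen_least[OF J] by blast
  then show ?thesis
    using mono inc by (intro exI[of _ N]) blast
qed

section \<open>Maximal radical differential ideals without finite basis\<close>

context
  fixes P
  assumes P: "rdi P" and nfg: "\<not> rdi_fg P" and max: "\<And>Q. rdi Q \<Longrightarrow> P \<subset> Q \<Longrightarrow> rdi_fg Q"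
begin

lemma maximal_insert:
  assumes "a \<notin> P"
  shows "\<exists>F. finite F \<and> F \<subseteq> P \<and> P \<subseteq> rdgen (insert a F)"
proof -
  have "rdi_fg (rdgen (insert a P))"
    using assms rdgen_superset[of "insert a P"] by (intro max rdi_rdgen) blast
  then obtain G where G: "finite G" "G \<subseteq> rdgen (insert a P)" "rdgen (insert a P) \<subseteq> rdgen G"
    unfolding rdi_fg_def by blast
  then obtain F where F: "finite F" "F \<subseteq> insert a P" "G \<subseteq> rdgen F"
    using rdgen_finitary_set by meson
  \<comment> \<open>\<open>F\<close> may contain \<open>a\<close>, which is not in \<open>P\<close>;
    it is split off so that the remaining generators lie in \<open>P\<close>.\<close>
  have "rdgen G \<subseteq> rdgen (insert a (F - {a}))"
    using rdgen_least[OF rdi_rdgen F(3)] rdgen_mono[of F "insert a (F - {a})"] by blast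
  then show ?thesis
    using F G(3) rdgen_superset[of "insert a P"] by (intro exI[of _ "F - {a}"]) auto
qed

text \<open>If \<open>a\<close> were not in \<open>P\<close>, then \<open>P\<close> would lie in
  \<open>rdgen (insert a F)\<close> with \<open>F\<close> a finite subset of \<open>P\<close>. Each
  \<open>p\<close> in \<open>P\<close> multiplies both \<open>a\<close> and \<open>F\<close> into
  \<open>rdgen (F \<union> G)\<close>, so \<open>p * p\<close>, and then \<open>p\<close>, lies
  there, and \<open>P\<close> would have a finite basis.\<close>

lemma maximal_colon:
  assumes "finite G" "G \<subseteq> P" "\<And>p. p \<in> P \<Longrightarrow> a * p \<in> rdgen G"
  shows "a \<in> P"
proof (rule ccontr)
  assume "a \<notin> P"
  then obtain F where F: "finite F" "F \<subseteq> P" "P \<subseteq> rdgen (insert a F)"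
    using maximal_insert by blast
  let ?I = "rdgen (F \<union> G)"
  have I: "rdi ?I" by (rule rdi_rdgen)
  have "p \<in> ?I" if p: "p \<in> P" for p
  proof -
    have "p * y \<in> ?I" if "y \<in> insert a F" for y
      using that assms(3)[OF p] rdgen_mono[of G "F \<union> G"] rdgen_superset[of "F \<union> G"] rdi_mult[OF I, of y p]
      by (auto simp: mult.commute[of p a])
    then have "p * p \<in> ?I"
      using mult_rdgen[OF I, of "insert a F" p p] F p by blast
    then show ?thesis
      using rdi_square I by blast
  qed
  then show False
    using nfg F assms(1,2) unfolding rdi_fg_def by (metis Un_subset_iff finite_UnI subsetI)
qed

text \<open>As \<open>P\<close> lies in \<open>rdgen (insert b F)\<close>, multiplication by
  \<open>a\<close> takes it into \<open>rdgen (insert (a * b) F)\<close>, which is finitely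
  generated by elements of \<open>P\<close>; \<open>maximal_colon\<close> then applies.\<close>

lemma maximal_prime:
  assumes "a * b \<in> P" "b \<notin> P"
  shows "a \<in> P"
proof -
  obtain F where F: "finite F" "F \<subseteq> P" "P \<subseteq> rdgen (insert b F)"
    using maximal_insert assms(2) by blast
  have I: "rdi (rdgen (insert (a * b) F))" by (rule rdi_rdgen)
  show ?thesis
  proof (rule maximal_colon)
    show "finite (insert (a * b) F)" "insert (a * b) F \<subseteq> P"
      using F assms by auto
    fix p assume "p \<in> P"
    then have "p \<in> rdgen (insert b F)"
      using F(3) by blast
    moreover have "a * y \<in> rdgen (insert (a * b) F)" if "y \<in> insert b F" for y
      using that rdgen_superset[of "insert (a * b) F"] rdi_mult[OF I, of y a] by blast
    ultimately show "a * p \<in> rdgen (insert (a * b) F)"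
      by (rule mult_rdgen[OF I, rotated])
  qed
qed

lemma maximal_proper: "1 \<notin> P"
proof
  assume "1 \<in> P"
  have "x \<in> rdgen {1}" for x
    using rdi_mult[OF rdi_rdgen[of "{1}"], of 1 x] rdgen_superset[of "{1}"] by simp
  then show False
    using nfg \<open>1 \<in> P\<close> unfolding rdi_fg_def by (metis empty_subsetI finite.simps insert_subset subsetI)
qed

end

end

subsection \<open>The Ritt--Raudenbush basis theorem\<close>

text \<open>\<open>K\<close> is a field of constants. By \<open>deriv_y\<close> the element
  \<open>y 0\<close> is a further constant, while \<open>y 1, y 2, ...\<close> are, up to invertible
  integer factors, the successive derivatives of the differential indeterminate \<open>y 1\<close>.
  The assumption \<open>generated\<close> expresses generation by \<open>K\<close> and the
  \<open>y n\<close> as an induction principle.\<close>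

locale differential_polynomials = derivation \<delta>
  for \<delta> :: "'a::comm_ring_1 \<Rightarrow> 'a" +
  fixes K :: "'a set" and y :: "nat \<Rightarrow> 'a"
  assumes one_K: "1 \<in> K" and uminus_K: "c \<in> K \<Longrightarrow> - c \<in> K"
    and add_K: "c \<in> K \<Longrightarrow> d \<in> K \<Longrightarrow> c + d \<in> K"
    and mult_K: "c \<in> K \<Longrightarrow> d \<in> K \<Longrightarrow> c * d \<in> K"
    and inverse_K: "c \<in> K \<Longrightarrow> c \<noteq> 0 \<Longrightarrow> \<exists>d\<in>K. c * d = 1"
    and char_0: "of_nat (Suc n) \<noteq> (0 :: 'a)"
    and deriv_K: "c \<in> K \<Longrightarrow> \<delta> c = 0"
    and deriv_y: "\<delta> (y n) = of_nat n * y (Suc n)"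
    and generated: "\<lbrakk>K \<subseteq> A; \<And>n. y n \<in> A; \<And>a b. a \<in> A \<Longrightarrow> b \<in> A \<Longrightarrow> a + b \<in> A;
        \<And>a b. a \<in> A \<Longrightarrow> b \<in> A \<Longrightarrow> a * b \<in> A\<rbrakk> \<Longrightarrow> x \<in> A"
begin

section \<open>The subrings \<open>V m = K[y 0, ..., y (m - 1)]\<close>\<close>

inductive_set V :: "nat \<Rightarrow> 'a set" for m where
  V_K: "c \<in> K \<Longrightarrow> c \<in> V m"
| V_y: "i < m \<Longrightarrow> y i \<in> V m"
| V_add: "a \<in> V m \<Longrightarrow> b \<in> V m \<Longrightarrow> a + b \<in> V m"
| V_mult: "a \<in> V m \<Longrightarrow> b \<in> V m \<Longrightarrow> a * b \<in> V m"

lemma V_mono: "a \<in> V m \<Longrightarrow> m \<le> n \<Longrightarrow> a \<in> V n"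
  by (induction rule: V.induct) (auto intro: V.intros)

lemma V_one: "1 \<in> V m"
  by (rule V_K[OF one_K])

lemma V_uminus: "a \<in> V m \<Longrightarrow> - a \<in> V m"
  using V_mult[OF V_K[OF uminus_K[OF one_K]], of a m] by simp

lemma V_diff: "a \<in> V m \<Longrightarrow> b \<in> V m \<Longrightarrow> a - b \<in> V m"
  using V_add[OF _ V_uminus, of a m b] by simp

lemma V_zero: "0 \<in> V m"
  using V_diff[OF V_one V_one] by simp

lemma V_power: "a \<in> V m \<Longrightarrow> a ^ n \<in> V m"
  by (induction n) (auto intro: V_one V_mult)

lemma of_nat_K: "of_nat (Suc n) \<in> K"
proof (induction n)
  case (Suc n)
  then show ?case
    using add_K[OF one_K] by (metis of_nat_Suc)
qed (simp add: one_K)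

lemma of_nat_V: "of_nat n \<in> V m"
  by (cases n) (use V_zero V_K[OF of_nat_K] in auto)

lemma of_nat_inverse: "n > 0 \<Longrightarrow> \<exists>d\<in>K. of_nat n * d = 1"
  using of_nat_K[of "n - 1"] inverse_K char_0[of "n - 1"] by simp

lemma V_exhaust: "\<exists>m. x \<in> V m"
proof -
  have ex: "\<exists>m. a \<in> V m \<and> b \<in> V m" if "\<exists>m. a \<in> V m" "\<exists>m. b \<in> V m" for a b
  proof -
    from that obtain m n where "a \<in> V m" "b \<in> V n" by blast
    then have "a \<in> V (max m n)" "b \<in> V (max m n)"
      by (auto intro: V_mono)
    then show ?thesis by blast
  qed
  have "x \<in> {x. \<exists>m. x \<in> V m}"
  proof (rule generated)
    show "y n \<in> {x. \<exists>m. x \<in> V m}" for n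
      using V_y[of n "Suc n"] by blast
  qed (use ex in \<open>blast intro: V_K V_add V_mult\<close>)+
  then show ?thesis by blast
qed

lemma deriv_V: "a \<in> V m \<Longrightarrow> \<delta> a \<in> V (Suc m)"
proof (induction rule: V.induct)
  case (V_mult a b)
  then show ?case
    unfolding deriv_mult by (intro V.intros(3,4)) (auto intro: V_mono)
qed (auto simp: deriv_K deriv_add deriv_y V_zero intro!: V.intros(2,3,4) of_nat_V)

text \<open>Membership only asks for some representation as a polynomial in \<open>y m\<close> of degree less than \<open>n\<close>:
  the \<open>y m\<close> are nowhere assumed to be algebraically independent.\<close>

primrec D :: "nat \<Rightarrow> nat \<Rightarrow> 'a set" where
  "D m 0 = {0}"
| "D m (Suc n) = {g + c * y m ^ n | g c. g \<in> D m n \<and> c \<in> V m}"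

lemma D_SucI: "g \<in> D m n \<Longrightarrow> c \<in> V m \<Longrightarrow> g + c * y m ^ n \<in> D m (Suc n)"
  by auto

lemma D_SucE:
  assumes "g \<in> D m (Suc n)"
  obtains g' c where "g = g' + c * y m ^ n" "g' \<in> D m n" "c \<in> V m"
  using assms by auto

declare D.simps(2) [simp del]

lemma D_mono_Suc: "g \<in> D m n \<Longrightarrow> g \<in> D m (Suc n)"
  using D_SucI[of g m n 0] V_zero by simp

lemma D_mono: "g \<in> D m n \<Longrightarrow> n \<le> n' \<Longrightarrow> g \<in> D m n'"
  by (rotate_tac, induction n' rule: dec_induct) (auto intro: D_mono_Suc)

lemma D_zero: "0 \<in> D m n"
  using D_mono[of 0 m 0 n] by simp

lemma D_add: "g \<in> D m n \<Longrightarrow> h \<in> D m n \<Longrightarrow> g + h \<in> D m n"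
proof (induction n arbitrary: g h)
  case (Suc n)
  obtain g' c where "g = g' + c * y m ^ n" "g' \<in> D m n" "c \<in> V m"
    using Suc.prems(1) by (rule D_SucE)
  moreover obtain h' d where "h = h' + d * y m ^ n" "h' \<in> D m n" "d \<in> V m"
    using Suc.prems(2) by (rule D_SucE)
  ultimately show ?case
    using D_SucI[OF Suc.IH V_add, of g' h' c d] by (simp add: algebra_simps)
qed simp

lemma D_mult_V: "g \<in> D m n \<Longrightarrow> a \<in> V m \<Longrightarrow> a * g \<in> D m n"
proof (induction n arbitrary: g)
  case (Suc n)
  then obtain g' c where "g = g' + c * y m ^ n" "g' \<in> D m n" "c \<in> V m"
    by (auto elim: D_SucE)
  then show ?case
    using D_SucI[OF Suc.IH V_mult, of g' a c] Suc.prems by (simp add: algebra_simps)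
qed simp

lemma D_mult_y: "g \<in> D m n \<Longrightarrow> y m * g \<in> D m (Suc n)"
proof (induction n arbitrary: g)
  case 0
  then show ?case
    using D_zero by auto
next
  case (Suc n)
  then obtain g' c where "g = g' + c * y m ^ n" "g' \<in> D m n" "c \<in> V m"
    by (auto elim: D_SucE)
  then show ?case
    using D_SucI[OF Suc.IH, of g' c] by (simp add: algebra_simps)
qed

lemma D_mult_y_power: "g \<in> D m n \<Longrightarrow> y m ^ k * g \<in> D m (n + k)"
  by (induction k) (use D_mult_y in \<open>auto simp: mult.assoc\<close>)

lemma D_uminus: "g \<in> D m n \<Longrightarrow> - g \<in> D m n"
  using D_mult_V[OF _ V_uminus[OF V_one]] by simp

lemma D_diff: "g \<in> D m n \<Longrightarrow> h \<in> D m n \<Longrightarrow> g - h \<in> D m n"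
  using D_add[OF _ D_uminus, of g m n h] by simp

lemma D_one_eq: "D m (Suc 0) = V m"
  by (auto simp: D.simps(2))

lemma D_mult: "g \<in> D m n \<Longrightarrow> h \<in> D m n' \<Longrightarrow> g * h \<in> D m (n + n')"
proof (induction n arbitrary: g)
  case 0
  then show ?case using D_zero by simp
next
  case (Suc n)
  then obtain g' c where g: "g = g' + c * y m ^ n" "g' \<in> D m n" "c \<in> V m"
    by (auto elim: D_SucE)
  then have "g' * h \<in> D m (Suc n + n')"
    using Suc D_mono_Suc by simp
  moreover have "c * (y m ^ n * h) \<in> D m (n' + n)"
    using D_mult_V D_mult_y_power g(3) Suc.prems(2) by blast
  then have "c * (y m ^ n * h) \<in> D m (Suc n + n')"
    by (rule D_mono) simp
  ultimately show ?case
    using D_add g(1) by (simp add: distrib_right mult.assoc)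
qed

lemma V_Suc_D: "a \<in> V (Suc m) \<Longrightarrow> \<exists>n. a \<in> D m n"
proof (induction rule: V.induct)
  case (V_K c)
  then show ?case
    using D_one_eq V.V_K by blast
next
  case (V_y i)
  show ?case
  proof (cases "i = m")
    case True
    then show ?thesis
      using D_mult_y[of 1 m "Suc 0"] V_one by (auto simp: D_one_eq)
  next
    case False
    then show ?thesis
      using V_y V.V_y[of i m] D_one_eq by (metis less_SucE)
  qed
next
  case (V_add a b)
  then obtain n n' where "a \<in> D m n" "b \<in> D m n'"
    by blast
  then have "a \<in> D m (max n n')" "b \<in> D m (max n n')"
    by (auto intro: D_mono)
  then show ?case
    using D_add by blast
next
  case (V_mult a b)
  then show ?case
    using D_mult by blast
qed

lemma D_subset_V: "g \<in> D m n \<Longrightarrow> g \<in> V (Suc m)"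
proof (induction n arbitrary: g)
  case (Suc n)
  then obtain g' c where "g = g' + c * y m ^ n" "g' \<in> D m n" "c \<in> V m"
    by (auto elim: D_SucE)
  then show ?case
    using Suc.IH by (auto intro!: V_add V_mult V_power V_y intro: V_mono)
qed (simp add: V_zero)

text \<open>The multiple \<open>u * f\<close> has the same top term as \<open>i * g\<close>, so
  \<open>i * g - u * f\<close> has a smaller degree bound in \<open>y m\<close>. Each such step
  costs one factor \<open>i\<close>, since \<open>i\<close> need not be invertible.\<close>

lemma pseudo_division:
  assumes f: "f = i * y m ^ d + r" "i \<in> V m" "r \<in> D m d"
  shows "g \<in> D m n \<Longrightarrow> \<exists>k h. i ^ k * g - h * f \<in> D m d"
proof (induction n arbitrary: g)
  case 0
  then show ?case
    using D_zero by (intro exI[of _ 0]) auto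
next
  case (Suc n)
  show ?case
  proof (cases "Suc n \<le> d")
    case True
    then have "i ^ 0 * g - 0 * f \<in> D m d"
      using D_mono[OF Suc.prems] by simp
    then show ?thesis by blast
  next
    case False
    obtain g' c where g: "g = g' + c * y m ^ n" "g' \<in> D m n" "c \<in> V m"
      using Suc.prems by (auto elim: D_SucE)
    define u where "u = c * y m ^ (n - d)"
    have y: "y m ^ n = y m ^ (n - d) * y m ^ d"
      using False by (simp flip: power_add)
    have "i * g - u * f = i * g' - c * (y m ^ (n - d) * r)"
      by (simp add: g f u_def y algebra_simps)
    moreover have "c * (y m ^ (n - d) * r) \<in> D m (d + (n - d))"
      by (intro D_mult_V D_mult_y_power f g)
    ultimately have "i * g - u * f \<in> D m n"
      using False D_diff D_mult_V[OF g(2) f(2)] by simp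
    then obtain k h where "i ^ k * (i * g - u * f) - h * f \<in> D m d"
      using Suc.IH by blast
    then have "i ^ Suc k * g - (i ^ k * u + h) * f \<in> D m d"
      by (simp add: algebra_simps)
    then show ?thesis by blast
  qed
qed

section \<open>Derivatives, separants and reduction modulo the derivatives of one element\<close>

lemma deriv_power: "\<delta> (a ^ n) = of_nat n * a ^ (n - 1) * \<delta> a"
proof (induction n)
  case (Suc n)
  then show ?case
    by (cases n) (simp_all add: deriv_mult algebra_simps)
qed simp

text \<open>Differentiating the coefficient brings in at most the variables up to
  \<open>y m\<close>; only the factor \<open>\<delta> (y m)\<close> can produce
  \<open>y (Suc m)\<close>.\<close>

lemma deriv_monomial:
  assumes "c \<in> V m"
  shows "\<delta> (c * y m ^ n) - of_nat n * c * y m ^ (n - 1) * \<delta> (y m) \<in> V (Suc m)"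
proof -
  have "\<delta> c * y m ^ n \<in> V (Suc m)"
    using assms by (intro V_mult V_power V_y deriv_V) auto
  then show ?thesis
    by (simp add: deriv_mult deriv_power algebra_simps)
qed

text \<open>The witness \<open>s\<close> is the formal partial derivative with respect to
  \<open>y m\<close> of a chosen representation of \<open>g\<close>, whence the degree bound
  \<open>n - 1\<close>.\<close>

lemma deriv_D:
  "g \<in> D m n \<Longrightarrow> \<exists>s\<in>D m (n - 1). \<delta> g - s * \<delta> (y m) \<in> V (Suc m)"
proof (induction n arbitrary: g)
  case 0
  then show ?case
    using V_zero by auto
next
  case (Suc n)
  then obtain g' c where g: "g = g' + c * y m ^ n" "g' \<in> D m n" "c \<in> V m"
    by (auto elim: D_SucE)
  then obtain s where s: "s \<in> D m (n - 1)" "\<delta> g' - s * \<delta> (y m) \<in> V (Suc m)"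
    using Suc.IH by blast
  define t where "t = s + of_nat n * c * y m ^ (n - 1)"
  have "\<delta> g - t * \<delta> (y m) = (\<delta> g' - s * \<delta> (y m)) +
      (\<delta> (c * y m ^ n) - of_nat n * c * y m ^ (n - 1) * \<delta> (y m))"
    by (simp add: g t_def deriv_add algebra_simps)
  then have "\<delta> g - t * \<delta> (y m) \<in> V (Suc m)"
    using V_add s(2) deriv_monomial g(3) by presburger
  moreover have "t \<in> D m n"
  proof (cases n)
    case 0
    then show ?thesis using s by (simp add: t_def)
  next
    case (Suc k)
    have "of_nat n * c \<in> V m"
      using g(3) by (intro V_mult of_nat_V)
    then show ?thesis
      using D_SucI[of s m k "of_nat n * c"] s(1) Suc by (simp add: t_def)
  qed
  ultimately show ?case
    by auto
qed

text \<open>The factor of \<open>\<delta> (y m)\<close> is the separant of \<open>i * y m ^ d + r\<close>.\<close>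

lemma separant:
  assumes "i \<in> V m" "r \<in> D m d"
  shows "\<exists>s\<in>D m (d - 1). \<delta> (i * y m ^ d + r) -
    (of_nat d * i * y m ^ (d - 1) + s) * \<delta> (y m) \<in> V (Suc m)"
proof -
  obtain s where s: "s \<in> D m (d - 1)" "\<delta> r - s * \<delta> (y m) \<in> V (Suc m)"
    using deriv_D assms(2) by blast
  have "\<delta> (i * y m ^ d + r) - (of_nat d * i * y m ^ (d - 1) + s) * \<delta> (y m) =
      (\<delta> (i * y m ^ d) - of_nat d * i * y m ^ (d - 1) * \<delta> (y m)) + (\<delta> r - s * \<delta> (y m))"
    by (simp add: deriv_add algebra_simps)
  then show ?thesis
    using s V_add deriv_monomial assms(1) by metis
qed

text \<open>Every proper derivative of \<open>f\<close> is linear in its highest variable, with the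
  separant as coefficient up to a positive integer. Passing from \<open>j\<close> to
  \<open>Suc j\<close> multiplies this integer by \<open>Suc m + j\<close>, the factor in
  \<open>deriv_y\<close>; the term in which \<open>s\<close> itself is differentiated stays in lower
  variables.\<close>

lemma deriv_iterate:
  assumes m: "m > 0" and s: "s \<in> V (Suc m)" "\<delta> f - s * \<delta> (y m) \<in> V (Suc m)"
  shows "\<exists>c>0. (\<delta> ^^ Suc j) f - of_nat c * s * y (Suc m + j) \<in> V (Suc m + j)"
proof (induction j)
  case 0
  then show ?case
    \<comment> \<open>The initial factor comes from
      \<open>\<delta> (y m) = of_nat m * y (Suc m)\<close>; it is positive because
      \<open>y 0\<close> is excluded.\<close>
    using m s by (intro exI[of _ m]) (simp add: deriv_y algebra_simps)
next
  case (Suc j)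
  let ?M = "Suc m + j"
  define F where "F = (\<delta> ^^ Suc j) f"
  obtain c where c: "c > 0" "F - of_nat c * s * y ?M \<in> V ?M"
    using Suc unfolding F_def by blast
  define t where "t = of_nat c * s"
  have "\<delta> t \<in> V (Suc (Suc m))"
    unfolding t_def by (intro deriv_V V_mult of_nat_V s)
  then have "\<delta> t * y ?M \<in> V (Suc ?M)"
    by (intro V_mult V_y) (auto intro: V_mono)
  moreover have "\<delta> (F - t * y ?M) \<in> V (Suc ?M)"
    using c by (intro deriv_V) (simp add: t_def)
  moreover have "\<delta> (F - t * y ?M) = \<delta> F - \<delta> t * y ?M - t * \<delta> (y ?M)"
    using deriv_add[of "F - t * y ?M" "t * y ?M"] by (simp add: deriv_mult algebra_simps)
  ultimately have "\<delta> F - t * \<delta> (y ?M) \<in> V (Suc ?M)"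
    using V_add[of "\<delta> (F - t * y ?M)" "Suc ?M" "\<delta> t * y ?M"] by simp
  moreover have "of_nat (c * ?M) * s * y (Suc ?M) = t * \<delta> (y ?M)"
    unfolding t_def deriv_y by (simp only: of_nat_mult ac_simps)
  ultimately have "\<delta> F - of_nat (c * ?M) * s * y (Suc ?M) \<in> V (Suc ?M)"
    by (simp only:)
  then show ?case
    using c(1) by (intro exI[of _ "c * ?M"]) (simp add: F_def del: of_nat_Suc of_nat_add of_nat_mult)
qed

lemma rdi_funpow_deriv: "rdi Q \<Longrightarrow> f \<in> Q \<Longrightarrow> (\<delta> ^^ n) f \<in> Q"
  by (induction n) (auto intro: rdi_deriv)

lemma rdi_cancel_unit:
  assumes "rdi Q" "u * v = 1" "u * a \<in> Q"
  shows "a \<in> Q"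
proof -
  have "v * (u * a) = a"
    using assms(2) by (metis mult.assoc mult.commute mult_1)
  then show ?thesis
    using rdi_mult[OF assms(1,3), of v] by simp
qed

text \<open>The elements that some power of \<open>s\<close> carries into \<open>V (Suc m)\<close>
  modulo \<open>Q\<close> are closed under sums and products, so only the variables need checking.
  For \<open>n > m\<close> a derivative of \<open>f\<close> lies in \<open>Q\<close> and is linear
  in \<open>y n\<close> with coefficient \<open>of_nat c * s\<close>; solving for \<open>y n\<close>
  costs one more factor \<open>s\<close>.\<close>

lemma separant_reduction:
  assumes Q: "rdi Q" "f \<in> Q" and m: "m > 0"
    and s: "s \<in> V (Suc m)" "\<delta> f - s * \<delta> (y m) \<in> V (Suc m)"
  shows "\<exists>k. \<exists>h\<in>V (Suc m). s ^ k * g - h \<in> Q"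
proof -
  let ?A = "{g. \<exists>k. \<exists>h\<in>V (Suc m). s ^ k * g - h \<in> Q}"
  have V: "a \<in> ?A" if "a \<in> V (Suc m)" for a
    using that Q by (intro CollectI exI[of _ 0] bexI[of _ a]) (simp_all add: rdi_zero)
  have add: "a + b \<in> ?A" if ab: "a \<in> ?A" "b \<in> ?A" for a b
  proof -
    obtain k h l h' where *: "h \<in> V (Suc m)" "s ^ k * a - h \<in> Q" "h' \<in> V (Suc m)" "s ^ l * b - h' \<in> Q"
      using ab by blast
    have "s ^ (k + l) * (a + b) - (s ^ l * h + s ^ k * h') =
        s ^ l * (s ^ k * a - h) + s ^ k * (s ^ l * b - h')"
      by (simp add: power_add algebra_simps)
    also have "\<dots> \<in> Q"
      by (intro rdi_add[OF Q(1)] rdi_mult[OF Q(1)] *)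
    finally show ?thesis
      using * s(1) by (blast intro: V_add V_mult V_power)
  qed
  have mult: "a * b \<in> ?A" if ab: "a \<in> ?A" "b \<in> ?A" for a b
  proof -
    obtain k h l h' where *: "h \<in> V (Suc m)" "s ^ k * a - h \<in> Q" "h' \<in> V (Suc m)" "s ^ l * b - h' \<in> Q"
      using ab by blast
    have "s ^ (k + l) * (a * b) - h * h' =
        (s ^ l * b) * (s ^ k * a - h) + h * (s ^ l * b - h')"
      by (simp add: power_add algebra_simps)
    also have "\<dots> \<in> Q"
      by (intro rdi_add[OF Q(1)] rdi_mult[OF Q(1)] *)
    finally show ?thesis
      using * by (blast intro: V_mult)
  qed
  have y: "y n \<in> ?A" for n
  proof (induction n rule: less_induct)
    case (less n)
    show ?case
    proof (cases "n \<le> m")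
      case True
      then show ?thesis
        by (intro V V_y) simp
    next
      case False
      then obtain j where n: "n = Suc m + j"
        by (metis add_Suc less_iff_Suc_add not_le)
      \<comment> \<open>The induction hypothesis covers the variables below \<open>y n\<close>;
        closure extends it to all polynomials in them.\<close>
      have Vn: "a \<in> ?A" if "a \<in> V n" for a
        using that
      proof (induction rule: V.induct)
        case (V_y i)
        then show ?case by (rule less)
      qed (rule V[OF V_K] add mult; assumption)+
      define F where "F = (\<delta> ^^ Suc j) f"
      obtain c where c: "c > 0" "F - of_nat c * s * y n \<in> V n"
        using deriv_iterate[OF m s] unfolding F_def n by blast
      obtain k h where h: "h \<in> V (Suc m)" "s ^ k * (F - of_nat c * s * y n) - h \<in> Q"
        using Vn[OF c(2)] by blast
      \<comment> \<open>Here characteristic zero enters: the integer factor is a unit of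
        \<open>K\<close>.\<close>
      obtain c' where c': "c' \<in> K" "of_nat c * c' = 1"
        using of_nat_inverse[OF c(1)] by blast
      have "c' * (s ^ k * F - (s ^ k * (F - of_nat c * s * y n) - h)) =
          (of_nat c * c') * (s ^ Suc k * y n) + c' * h"
        by (simp add: algebra_simps)
      also have "\<dots> = s ^ Suc k * y n - - (c' * h)"
        by (simp add: c')
      finally have "s ^ Suc k * y n - - (c' * h) \<in> Q"
        using h(2) rdi_funpow_deriv[OF Q, of "Suc j", folded F_def]
        by (metis rdi_diff rdi_mult Q(1))
      moreover have "- (c' * h) \<in> V (Suc m)"
        by (intro V_uminus V_mult V_K c' h)
      ultimately show ?thesis
        by blast
    qed
  qed
  have "g \<in> ?A"
    by (rule generated) (use V[OF V_K] y add mult in blast)+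
  then show ?thesis by blast
qed

section \<open>Elements of minimal rank\<close>

context
  fixes P
  assumes P: "rdi P"
begin

text \<open>The pairs \<open>(m, d)\<close> are the ranks of those elements of \<open>P\<close> whose initial is not in \<open>P\<close>.\<close>

definition leader :: "nat \<Rightarrow> nat \<Rightarrow> bool" where
  "leader m d \<longleftrightarrow> (\<exists>i\<in>V m - P. \<exists>r\<in>D m d. i * y m ^ d + r \<in> P)"

text \<open>Without leaders of positive degree, the top coefficient of an element of
  \<open>P\<close> lies in \<open>P\<close>, hence in \<open>Q\<close> by \<open>le\<close>.
  Removing the top term gives an element of \<open>P\<close> with a smaller degree bound.\<close>

lemma no_leader_D:
  assumes Q: "rdi Q" and le: "\<And>a. a \<in> P \<Longrightarrow> a \<in> V m \<Longrightarrow> a \<in> Q"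
  shows "(\<And>d. 0 < d \<Longrightarrow> d < n \<Longrightarrow> \<not> leader m d) \<Longrightarrow> g \<in> P \<Longrightarrow> g \<in> D m n \<Longrightarrow> g \<in> Q"
proof (induction n arbitrary: g)
  case 0
  then show ?case
    using rdi_zero[OF Q] by simp
next
  case (Suc n)
  obtain g' c where g: "g = c * y m ^ n + g'" "g' \<in> D m n" "c \<in> V m"
    using Suc.prems(3) by (auto elim!: D_SucE simp: add.commute)
  have c: "c \<in> P"
  \<comment> \<open>For \<open>n = 0\<close> the rest \<open>g'\<close> is zero and \<open>c\<close>
    is \<open>g\<close> itself, so leaders of degree 0 never have to be excluded.\<close>
  proof (cases n)
    case 0
    then show ?thesis
      using g Suc.prems(2) by simp
  next
    case (Suc k)
    then have "\<not> leader m n"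
      using Suc.prems(1) by simp
    then show ?thesis
      using g Suc.prems(2) unfolding leader_def by blast
  qed
  have "c * y m ^ n \<in> P"
    using rdi_mult[OF P c, of "y m ^ n"] by (simp add: mult.commute)
  then have "g' \<in> P"
    using rdi_diff[OF P Suc.prems(2), of "c * y m ^ n"] by (simp add: g)
  then have "g' \<in> Q"
    using Suc.IH Suc.prems(1) g(2) by simp
  moreover have "c * y m ^ n \<in> Q"
    using rdi_mult[OF Q le[OF c g(3)], of "y m ^ n"] by (simp add: mult.commute)
  ultimately show ?case
    using rdi_add[OF Q] g(1) by simp
qed

text \<open>The remainder of \<open>g\<close> under pseudo-division by the minimal element is again
  in \<open>P\<close> and too small in degree to be obstructed by a leader, so
  \<open>no_leader_D\<close> puts it into \<open>Q\<close>.\<close>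

lemma minimal_leader_V_Suc:
  assumes Q: "rdi Q" and le: "\<And>a. a \<in> P \<Longrightarrow> a \<in> V m \<Longrightarrow> a \<in> Q"
    and min: "\<And>d'. 0 < d' \<Longrightarrow> d' < d \<Longrightarrow> \<not> leader m d'"
    and f: "i \<in> V m" "r \<in> D m d" "i * y m ^ d + r \<in> P" "i * y m ^ d + r \<in> Q"
    and g: "g \<in> P" "g \<in> V (Suc m)"
  shows "\<exists>k. i ^ k * g \<in> Q"
proof -
  let ?f = "i * y m ^ d + r"
  obtain n where "g \<in> D m n"
    using V_Suc_D g(2) by blast
  then obtain k h where k: "i ^ k * g - h * ?f \<in> D m d"
    using pseudo_division[OF refl f(1,2)] by blast
  have "i ^ k * g - h * ?f \<in> P"
    by (intro rdi_diff[OF P] rdi_mult[OF P] f g)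
  then have "i ^ k * g - h * ?f \<in> Q"
    using no_leader_D[OF Q le min] k by blast
  then show ?thesis
    using rdi_add[OF Q, of _ "h * ?f"] rdi_mult[OF Q f(4), of h] by fastforce
qed

lemma V_0: "a \<in> V 0 \<Longrightarrow> a \<in> K"
  by (induction rule: V.induct) (auto intro: add_K mult_K)

lemma constant_in_proper:
  assumes "1 \<notin> P" "c \<in> V 0" "c \<in> P"
  shows "c = 0"
proof (rule ccontr)
  assume "c \<noteq> 0"
  then obtain d where "c * d = 1"
    using inverse_K V_0 assms(2) by blast
  then show False
    using assms(1) rdi_mult[OF P assms(3), of d] by (simp add: mult.commute)
qed

text \<open>The variable \<open>y 0\<close> is treated apart, since it is a constant and separant
  reduction needs \<open>m > 0\<close>. Over the field \<open>K\<close> initials are units, so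
  pseudo-division becomes the division of a polynomial ring in one variable, and an element of least
  degree suffices.\<close>

lemma principal_V_1:
  assumes "1 \<notin> P"
  shows "\<exists>a\<in>P. \<forall>g\<in>P. g \<in> V (Suc 0) \<longrightarrow> g \<in> rdgen {a}"
proof (cases "\<exists>d>0. leader 0 d")
  case True
  define d where "d = (LEAST d. 0 < d \<and> leader 0 d)"
  have d: "0 < d" "leader 0 d"
    using LeastI_ex[OF True[folded conj_commute]] by (auto simp: d_def)
  have min: "\<not> leader 0 d'" if "0 < d'" "d' < d" for d'
    using that not_less_Least unfolding d_def by blast
  obtain i r where i: "i \<in> V 0" "i \<notin> P" "r \<in> D 0 d" "i * y 0 ^ d + r \<in> P"
    using d(2) unfolding leader_def by blast
  let ?Q = "rdgen {i * y 0 ^ d + r}"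
  have Q: "rdi ?Q" "i * y 0 ^ d + r \<in> ?Q"
    using rdi_rdgen rdgen_superset by blast+
  have "i \<noteq> 0"
    using i(2) rdi_zero[OF P] by blast
  then obtain j where j: "i * j = 1"
    using inverse_K V_0[OF i(1)] by blast
  have "g \<in> ?Q" if g: "g \<in> P" "g \<in> V (Suc 0)" for g
  proof -
    have "\<exists>k. i ^ k * g \<in> ?Q"
      by (rule minimal_leader_V_Suc[OF Q(1) _ min i(1,3,4) Q(2) g])
        (use constant_in_proper[OF assms] rdi_zero[OF Q(1)] in auto)
    then obtain k where "i ^ k * g \<in> ?Q" ..
    moreover have "i ^ k * j ^ k = 1"
      using j by (simp flip: power_mult_distrib)
    ultimately show ?thesis
      using rdi_cancel_unit[OF Q(1)] by blast
  qed
  then show ?thesis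
    using i(4) by blast
next
  case False
  have "g \<in> rdgen {0}" if g: "g \<in> P" "g \<in> V (Suc 0)" for g
  proof -
    obtain n where "g \<in> D 0 n"
      using V_Suc_D g(2) by blast
    then show ?thesis
      by (rule no_leader_D[OF rdi_rdgen _ _ g(1), rotated 2])
        (use constant_in_proper[OF assms] rdi_zero[OF rdi_rdgen] False in blast)+
  qed
  then show ?thesis
    using rdi_zero[OF P] by blast
qed

text \<open>Induction over the highest variable, with \<open>no_leader_D\<close> at each stage;
  \<open>le\<close> supplies the part in \<open>y 0\<close>, so leaders at \<open>m' = 0\<close> are
  allowed.\<close>

lemma no_leader_V:
  assumes Q: "rdi Q" and le: "\<And>g. g \<in> P \<Longrightarrow> g \<in> V (Suc 0) \<Longrightarrow> g \<in> Q"
  shows "(\<And>m' d. 0 < m' \<Longrightarrow> m' < m \<Longrightarrow> 0 < d \<Longrightarrow> \<not> leader m' d) \<Longrightarrow> g \<in> P \<Longrightarrow> g \<in> V m \<Longrightarrow> g \<in> Q"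
proof (induction m arbitrary: g)
  case 0
  then show ?case
    using le V_mono[of g 0 "Suc 0"] by simp
next
  case (Suc m)
  show ?case
  proof (cases "m = 0")
    case True
    then show ?thesis
      using le Suc.prems by simp
  next
    case False
    obtain n where n: "g \<in> D m n"
      using V_Suc_D Suc.prems(3) by blast
    show ?thesis
    proof (rule no_leader_D[OF Q _ _ Suc.prems(2) n])
      show "a \<in> Q" if "a \<in> P" "a \<in> V m" for a
        using that Suc.IH Suc.prems(1) by simp
      show "\<not> leader m d" if "0 < d" for d
        using that Suc.prems(1)[of m d] False by simp
    qed
  qed
qed

lemma of_nat_mult_not_in:
  assumes "0 < n" "a \<notin> P"
  shows "of_nat n * a \<notin> P"
  using of_nat_inverse[OF assms(1)] rdi_cancel_unit[OF P] assms(2) by blast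

theorem maximal_not_fg_contradiction:
  assumes nfg: "\<not> rdi_fg P" and max: "\<And>Q. rdi Q \<Longrightarrow> P \<subset> Q \<Longrightarrow> rdi_fg Q"
  shows False
proof -
  note maximal = P nfg max
  \<comment> \<open>This element accounts for the part of \<open>P\<close> in the constants
    \<open>K[y 0]\<close>; the element of minimal rank is then sought among the \<open>y m\<close>
    with \<open>m > 0\<close>.\<close>
  obtain a where a: "a \<in> P" "\<And>g. g \<in> P \<Longrightarrow> g \<in> V (Suc 0) \<Longrightarrow> g \<in> rdgen {a}"
    using principal_V_1[OF maximal_proper[OF maximal]] by blast
  have ex: "\<exists>m. 0 < m \<and> (\<exists>d>0. leader m d)"
  proof (rule ccontr)
    assume *: "\<not> ?thesis"
    have "g \<in> rdgen {a}" if "g \<in> P" for g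
    proof -
      obtain m where "g \<in> V m"
        using V_exhaust by blast
      then show ?thesis
        using no_leader_V[OF rdi_rdgen a(2) _ that] * by blast
    qed
    then have "P \<subseteq> rdgen {a}"
      by blast
    then show False
      using nfg a(1) unfolding rdi_fg_def by (metis empty_subsetI finite.simps insert_subset)
  qed
  define m where "m = (LEAST m. 0 < m \<and> (\<exists>d>0. leader m d))"
  have m: "0 < m" "\<exists>d>0. leader m d"
    using LeastI_ex[OF ex] by (auto simp: m_def)
  have m_min: "\<not> leader m' d" if "0 < m'" "m' < m" "0 < d" for m' d
    using that not_less_Least[of m' "\<lambda>m. 0 < m \<and> (\<exists>d>0. leader m d)"]
    unfolding m_def by blast
  \<comment> \<open>The rank is minimised lexicographically: first the index of the variable, then
    the degree.\<close>
  define d where "d = (LEAST d. 0 < d \<and> leader m d)"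
  have d: "0 < d" "leader m d"
    using LeastI_ex[of "\<lambda>d. 0 < d \<and> leader m d"] m(2) by (auto simp: d_def)
  have d_min: "\<not> leader m d'" if "0 < d'" "d' < d" for d'
    using that not_less_Least[of d' "\<lambda>d. 0 < d \<and> leader m d"] unfolding d_def by blast
  obtain i r where i: "i \<in> V m" "i \<notin> P" "r \<in> D m d" and f: "i * y m ^ d + r \<in> P"
    using d(2) unfolding leader_def by blast
  define f where "f = i * y m ^ d + r"
  obtain s' where s': "s' \<in> D m (d - 1)"
    "\<delta> f - (of_nat d * i * y m ^ (d - 1) + s') * \<delta> (y m) \<in> V (Suc m)"
    using separant[OF i(1,3)] unfolding f_def by blast
  define s where "s = of_nat d * i * y m ^ (d - 1) + s'"
  have di: "of_nat d * i \<in> V m" "of_nat d * i \<notin> P"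
    using i d(1) by (auto intro: V_mult of_nat_V simp: of_nat_mult_not_in)
  have sV: "s \<in> V (Suc m)"
    unfolding s_def using D_SucI[OF s'(1) di(1)] D_subset_V by (metis add.commute)
  \<comment> \<open>For \<open>d = 1\<close> the set \<open>D m 0\<close> is zero and the separant
    is the initial. Otherwise a separant in \<open>P\<close>, having initial
    \<open>of_nat d * i\<close>, would give a leader of degree \<open>d - 1\<close>.\<close>
  have sP: "s \<notin> P"
  proof (cases "d = 1")
    case True
    then show ?thesis
      using s'(1) di by (simp add: s_def)
  next
    case False
    then have "\<not> leader m (d - 1)"
      using d_min d(1) by simp
    then show ?thesis
      using di s'(1) unfolding leader_def s_def by blast
  qed
  let ?Q = "rdgen {f, a}"
  have Q: "rdi ?Q" "f \<in> ?Q"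
    using rdi_rdgen rdgen_superset by blast+
  have QP: "?Q \<subseteq> P"
    using rdgen_least[OF P] f a(1) by (simp add: f_def)
  have le: "g \<in> ?Q" if "g \<in> P" "g \<in> V m" for g
  proof (rule no_leader_V[OF Q(1) _ m_min that])
    show "g \<in> ?Q" if "g \<in> P" "g \<in> V (Suc 0)" for g
      using a(2)[OF that] rdgen_mono[of "{a}" "{f, a}"] by blast
  qed
  have "i * s \<in> P"
  proof (rule maximal_colon[OF maximal])
    show "finite {f, a}" "{f, a} \<subseteq> P"
      using f a(1) by (auto simp: f_def)
  next
    fix p assume p: "p \<in> P"
    obtain k h where h: "h \<in> V (Suc m)" "s ^ k * p - h \<in> ?Q"
      using separant_reduction[OF Q m(1) sV s'(2)[folded s_def]] by blast
    have "s ^ k * p - (s ^ k * p - h) \<in> P"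
      by (rule rdi_diff[OF P rdi_mult[OF P p] subsetD[OF QP h(2)]])
    then have "h \<in> P"
      by simp
    moreover have "i * y m ^ d + r \<in> ?Q"
      using Q(2) unfolding f_def .
    ultimately obtain l where l: "i ^ l * h \<in> ?Q"
      using minimal_leader_V_Suc[OF Q(1) le d_min i(1,3) f] h(1) by blast
    \<comment> \<open>The exponent is large enough to split off both \<open>i ^ l\<close> and
      \<open>s ^ k\<close>; the remaining expression is \<open>i ^ l * s ^ k * p\<close> written as
      a sum of two elements of \<open>?Q\<close>.\<close>
    have "(i * s * p) ^ (k + l + 1) =
        (i ^ Suc k * s ^ Suc l * p ^ (k + l)) * (i ^ l * (s ^ k * p - h) + i ^ l * h)"
      by (simp add: power_add power_mult_distrib algebra_simps)
    also have "\<dots> \<in> ?Q"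
      by (intro rdi_mult[OF Q(1)] rdi_add[OF Q(1)] l h)
    finally show "i * s * p \<in> ?Q"
      by (rule rdi_power[OF Q(1)])
  qed
  then show False
    using maximal_prime[OF maximal] i(2) sP by blast
qed

end

theorem Ritt_Raudenbush:
  assumes "rdi I"
  shows "rdi_fg I"
  using rdi_maximal_not_fg[OF assms] maximal_not_fg_contradiction by blast

end

subsection \<open>Linear maps on monoid algebras\<close>

abbreviation "lookup \<equiv> Poly_Mapping.lookup"
abbreviation "keys \<equiv> Poly_Mapping.keys"
abbreviation "single \<equiv> Poly_Mapping.single"

abbreviation const :: "'k \<Rightarrow> 'b::monoid_add \<Rightarrow>\<^sub>0 'k::comm_ring_1" where
  "const c \<equiv> single 0 c"

lemma poly_mapping_sum_single:
  fixes p :: "'a \<Rightarrow>\<^sub>0 'b::comm_monoid_add"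
  shows "p = (\<Sum>k\<in>keys p. single k (lookup p k))"
proof (rule poly_mapping_eqI)
  fix i
  have "lookup (\<Sum>k\<in>keys p. single k (lookup p k)) i = (\<Sum>k\<in>keys p. if k = i then lookup p k else 0)"
    by (simp add: lookup_sum lookup_single when_def)
  also have "\<dots> = lookup p i"
    by (simp add: sum.delta in_keys_iff)
  finally show "lookup p i = lookup (\<Sum>k\<in>keys p. single k (lookup p k)) i"
    by simp
qed

text \<open>Only monomials from the support of \<open>p\<close> occur, so the induction also works
  for properties that depend on a bound on the support, such as membership in a filtration
  step.\<close>

lemma poly_mapping_keys_induct:
  fixes p :: "'a \<Rightarrow>\<^sub>0 'b::comm_monoid_add"
  assumes zero: "P 0" and single: "\<And>k v. k \<in> keys p \<Longrightarrow> P (single k v)"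
    and add: "\<And>f g. P f \<Longrightarrow> P g \<Longrightarrow> P (f + g)"
  shows "P p"
proof -
  have "P (\<Sum>k\<in>A. single k (lookup p k))" if "finite A" "A \<subseteq> keys p" for A
    using that by (induction A rule: finite_induct) (auto intro: assms)
  then show ?thesis
    using poly_mapping_sum_single[of p] by (metis finite_keys order_refl)
qed

lemma poly_mapping_induct [case_names zero single add]:
  fixes p :: "'a \<Rightarrow>\<^sub>0 'b::comm_monoid_add"
  assumes "P 0" "\<And>k v. P (single k v)" "\<And>f g. P f \<Longrightarrow> P g \<Longrightarrow> P (f + g)"
  shows "P p"
  by (rule poly_mapping_keys_induct) (use assms in auto)

lemma const_mult_single: "const c * single k v = single k (c * v)"
  by (simp add: mult_single)

lemma single_eq_const_mult: "single k c = const c * single k 1"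
  by (simp add: mult_single)

lemma const_mult: "const (a * b) = const a * const b"
  by (simp add: mult_single)

lemma lookup_const_mult: "lookup (const c * p) k = c * lookup p k"
  by (induction p rule: poly_mapping_induct)
    (simp_all add: const_mult_single lookup_single when_def distrib_left lookup_add)

text \<open>The linear extension of \<open>f\<close> from basis elements, with scalars acting
  through \<open>const\<close>.\<close>

definition lin :: "('w \<Rightarrow> 'b::monoid_add \<Rightarrow>\<^sub>0 'k) \<Rightarrow> ('w \<Rightarrow>\<^sub>0 'k) \<Rightarrow> 'b \<Rightarrow>\<^sub>0 'k::comm_ring_1" where
  "lin f p = (\<Sum>w\<in>keys p. const (lookup p w) * f w)"

lemma lin_superset:
  assumes "finite A" "keys p \<subseteq> A"
  shows "lin f p = (\<Sum>w\<in>A. const (lookup p w) * f w)"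
  unfolding lin_def using assms
  by (intro sum.mono_neutral_left) (auto simp: in_keys_iff)

lemma lin_zero [simp]: "lin f 0 = 0"
  by (simp add: lin_def)

lemma lin_single [simp]: "lin f (single w c) = const c * f w"
  by (simp add: lin_def)

lemma lin_add: "lin f (p + q) = lin f p + lin f q"
proof -
  let ?A = "keys p \<union> keys q"
  have "lin f (p + q) = (\<Sum>w\<in>?A. const (lookup (p + q) w) * f w)"
    using Poly_Mapping.keys_add[of p q] by (intro lin_superset) auto
  moreover have "lin f p = (\<Sum>w\<in>?A. const (lookup p w) * f w)"
    by (intro lin_superset) auto
  moreover have "lin f q = (\<Sum>w\<in>?A. const (lookup q w) * f w)"
    by (intro lin_superset) auto
  ultimately show ?thesis
    by (simp add: lookup_add single_add distrib_right sum.distrib)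
qed

lemma lin_const_mult: "lin f (const c * p) = const c * lin f p"
  by (induction p rule: poly_mapping_induct)
    (simp_all add: const_mult_single lin_add distrib_left flip: mult.assoc)

lemma lin_uminus: "lin f (- p) = - lin f p"
  using lin_add[of f p "- p"] by (simp add: add_eq_0_iff)

lemma lin_diff: "lin f (p - q) = lin f p - lin f q"
  using lin_add[of f p "- q"] by (simp add: lin_uminus)

lemma keys_diff: "keys (f - g) \<subseteq> keys f \<union> keys g"
  by (auto simp: in_keys_iff lookup_minus)

subsection \<open>Derivations of the symmetric algebra\<close>

abbreviation monom_of :: "(num \<Rightarrow>\<^sub>0 nat) \<Rightarrow> 'k::field_char_0 witt_sym" where
  "monom_of a \<equiv> single a 1"

abbreviation gen :: "num \<Rightarrow> 'k::field_char_0 witt_sym" where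
  "gen i \<equiv> monom_of (single i 1)"

lemma sym_induct [case_names const gen add mult]:
  fixes s :: "'k::field_char_0 witt_sym"
  assumes const: "\<And>c. P (const c)" and gen: "\<And>i. P (gen i)"
    and add: "\<And>f g. P f \<Longrightarrow> P g \<Longrightarrow> P (f + g)" and mult: "\<And>f g. P f \<Longrightarrow> P g \<Longrightarrow> P (f * g)"
  shows "P s"
proof (induction s rule: poly_mapping_induct)
  case zero
  then show ?case using const[of 0] by simp
next
  case (single a c)
  have "P (monom_of a)"
  proof (induction a rule: poly_mapping_induct)
    case zero
    then show ?case using const[of 1] by simp
  next
    case (single i n)
    show ?case
    proof (induction n)
      case 0
      then show ?case using const[of 1] by simp
    next
      case (Suc n)
      have "monom_of (single i (Suc n)) = gen i * monom_of (single i n)"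
        by (simp add: mult_single flip: single_add)
      then show ?case using mult[OF gen Suc] by metis
    qed
  next
    case (add a b)
    then show ?case using mult[OF add] by (simp add: mult_single)
  qed
  then show ?case
    using mult[OF const[of c], of "monom_of a"] by (simp add: mult_single)
next
  case (add f g)
  then show ?case by (rule assms)
qed

text \<open>The derivation that takes the prescribed value \<open>\<phi> i\<close> on the generator
  \<open>gen i\<close>, that is the sum of \<open>\<phi> i\<close> times the partial
  derivatives.\<close>

definition sym_deriv :: "(num \<Rightarrow> 'k::field_char_0 witt_sym) \<Rightarrow> 'k witt_sym \<Rightarrow> 'k witt_sym" where
  "sym_deriv \<phi> = lin (\<lambda>a. \<Sum>i\<in>keys a. single (a - single i 1) (of_nat (lookup a i)) * \<phi> i)"

lemma sym_deriv_X:
  assumes "finite A" "keys a \<subseteq> A"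
  shows "sym_deriv \<phi> (monom_of a) = (\<Sum>i\<in>A. single (a - single i 1) (of_nat (lookup a i)) * \<phi> i)"
proof -
  have "sym_deriv \<phi> (monom_of a) = (\<Sum>i\<in>keys a. single (a - single i 1) (of_nat (lookup a i)) * \<phi> i)"
    by (simp add: sym_deriv_def)
  also have "\<dots> = (\<Sum>i\<in>A. single (a - single i 1) (of_nat (lookup a i)) * \<phi> i)"
    using assms by (intro sum.mono_neutral_left) (auto simp: in_keys_iff)
  finally show ?thesis .
qed

lemma sym_deriv_e [simp]: "sym_deriv \<phi> (gen i) = \<phi> i"
  by (simp add: sym_deriv_def)

lemma sym_deriv_const [simp]: "sym_deriv \<phi> (const c) = 0"
  by (simp add: sym_deriv_def)

lemma sym_deriv_zero [simp]: "sym_deriv \<phi> 0 = 0"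
  by (simp add: sym_deriv_def)

lemma sym_deriv_const_mult: "sym_deriv \<phi> (const c * s) = const c * sym_deriv \<phi> s"
  by (simp add: sym_deriv_def lin_const_mult)

lemma sym_deriv_add: "sym_deriv \<phi> (s + t) = sym_deriv \<phi> s + sym_deriv \<phi> t"
  by (simp add: sym_deriv_def lin_add)

lemma sym_deriv_mult_X:
  "sym_deriv \<phi> (monom_of a * monom_of b) = sym_deriv \<phi> (monom_of a) * monom_of b + monom_of a * sym_deriv \<phi> (monom_of b)"
proof -
  let ?A = "keys a \<union> keys b"
  have leibniz: "single (a + b - single i 1) (of_nat (lookup (a + b) i)) =
    single (a - single i 1) (of_nat (lookup a i)) * monom_of b +
    monom_of a * single (b - single i 1) (of_nat (lookup b i) :: 'a)" for i
  proof -
    \<comment> \<open>Subtraction of exponents is truncated, so it commutes with adding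
      \<open>b\<close> only if \<open>i\<close> occurs in \<open>a\<close>; otherwise the
      coefficient vanishes.\<close>
    have 1: "a + b - single i 1 = (a - single i 1) + b" if "lookup a i \<noteq> 0" for a b :: "num \<Rightarrow>\<^sub>0 nat"
      using that by (intro poly_mapping_eqI) (auto simp: lookup_minus lookup_add lookup_single when_def)
    have "single (a + b - single i 1) (of_nat (lookup a i)) = single (a - single i 1) (of_nat (lookup a i)) * monom_of b"
      using 1[of a b] by (cases "lookup a i = 0") (simp_all add: mult_single)
    moreover have "single (a + b - single i 1) (of_nat (lookup b i)) = monom_of a * single (b - single i 1) (of_nat (lookup b i) :: 'a)"
      using 1[of b a] by (cases "lookup b i = 0") (simp_all add: mult_single add.commute)
    ultimately show ?thesis
      by (simp add: lookup_add single_add)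
  qed
  have "sym_deriv \<phi> (monom_of a * monom_of b) = (\<Sum>i\<in>?A. single (a + b - single i 1) (of_nat (lookup (a + b) i)) * \<phi> i)"
    using Poly_Mapping.keys_add[of a b] by (simp only: mult_single mult_1, intro sym_deriv_X) auto
  also have "\<dots> = sym_deriv \<phi> (monom_of a) * monom_of b + monom_of a * sym_deriv \<phi> (monom_of b)"
    unfolding leibniz sym_deriv_X[of ?A a, OF _ Un_upper1, simplified] sym_deriv_X[of ?A b, OF _ Un_upper2, simplified]
    by (simp add: sum_distrib_left sum_distrib_right algebra_simps sum.distrib)
  finally show ?thesis .
qed

lemma sym_deriv_mult: "sym_deriv \<phi> (s * t) = sym_deriv \<phi> s * t + s * sym_deriv \<phi> t"
proof (induction s rule: poly_mapping_induct)
  case (single a c)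
  show ?case
  proof (induction t rule: poly_mapping_induct)
    case (single b d)
    have s: "single a c = const c * monom_of a" "single b d = const d * monom_of b"
      by (simp_all add: mult_single)
    have "const c * monom_of a * (const d * monom_of b) = const c * (const d * (monom_of a * monom_of b))"
      by (simp only: ac_simps)
    then show ?case
      by (simp only: s sym_deriv_mult_X sym_deriv_const_mult distrib_left ac_simps)
  next
    case (add f g)
    then show ?case
      by (simp only: distrib_left sym_deriv_add add_ac)
  qed simp
next
  case (add f g)
  then show ?case
    by (simp only: distrib_right sym_deriv_add add_ac)
qed simp

subsection \<open>A representation of the enveloping algebra on the symmetric algebra\<close>

text \<open>
  The vector fields \<open>\<Sum>\<^sub>a x\<^sub>a\<^bsup>j+1\<^esup> \<partial>/\<partial>x\<^sub>a\<close> satisfy the relations of \<open>W\<^sub>+\<close>, also after conjugation with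
  \<open>exp (\<Sum>\<^sub>a x\<^sub>a y\<^sub>a)\<close>.  In terms of the functions \<open>e\<^sub>i = \<Sum>\<^sub>a x\<^sub>a\<^bsup>i+1\<^esup> y\<^sub>a\<close> this becomes an action of
  \<open>e\<^sub>j\<close> on the symmetric algebra by \<open>e\<^sub>j\<close> plus a derivation of degree zero.
\<close>

definition shift_deriv :: "num \<Rightarrow> 'k::field_char_0 witt_sym \<Rightarrow> 'k witt_sym" where
  "shift_deriv j = sym_deriv (\<lambda>i. single (single (i + j) 1) (numeral i + 1))"

definition act_gen :: "num \<Rightarrow> 'k::field_char_0 witt_sym \<Rightarrow> 'k witt_sym" where
  "act_gen j s = gen j * s + shift_deriv j s"

lemma shift_deriv_gen: "shift_deriv j (gen i) = const (numeral i + 1) * gen (i + j)"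
  unfolding shift_deriv_def sym_deriv_e by (rule single_eq_const_mult)

lemma shift_deriv_const [simp]: "shift_deriv j (const c) = 0"
  and shift_deriv_add: "shift_deriv j (s + t) = shift_deriv j s + shift_deriv j t"
  and shift_deriv_mult: "shift_deriv j (s * t) = shift_deriv j s * t + s * shift_deriv j t"
  by (simp_all only: shift_deriv_def sym_deriv_const sym_deriv_add sym_deriv_mult)

lemma shift_deriv_zero [simp]: "shift_deriv j 0 = 0"
  using shift_deriv_const[of j 0] by simp

lemma shift_deriv_const_mult: "shift_deriv j (const c * s) = const c * shift_deriv j s"
  by (simp only: shift_deriv_def sym_deriv_const_mult)

lemma num_add_ac:
  fixes i j n :: num
  shows "i + j + n = i + (j + n)" "i + j = j + i" "i + (j + n) = j + (i + n)"
  by (simp_all add: num_eq_iff nat_of_num_add)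

lemma numeral_diff_cancel:
  "(numeral (n + j) + 1) - (numeral (n + i) + 1) = (numeral j - numeral i :: 'a::comm_ring_1)"
  unfolding numeral_add by (rule trans[OF add_diff_cancel_right add_diff_cancel_left])

lemma const_mult_diff:
  "const a * (const b * g) - const a * (const c * g) = const (b - c) * (const a * g)"
  for g :: "'k::field_char_0 witt_sym"
  by (simp add: single_diff algebra_simps)

text \<open>Both sides are derivations, so the identity reduces to generators, where the
  coefficients \<open>n + j + 1\<close> and \<open>n + i + 1\<close> differ by
  \<open>j - i\<close>.\<close>

lemma shift_deriv_commutator:
  fixes s :: "'k::field_char_0 witt_sym"
  shows "shift_deriv i (shift_deriv j s) - shift_deriv j (shift_deriv i s) = const (numeral j - numeral i) * shift_deriv (i + j) s"
proof (induction s rule: sym_induct)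
  case (const c)
  then show ?case by simp
next
  case (gen n)
  have "shift_deriv i (shift_deriv j (gen n :: 'k witt_sym)) = const (numeral n + 1) * (const (numeral (n + j) + 1) * gen (n + (i + j)))"
    by (simp only: shift_deriv_gen shift_deriv_const_mult num_add_ac)
  moreover have "shift_deriv j (shift_deriv i (gen n :: 'k witt_sym)) = const (numeral n + 1) * (const (numeral (n + i) + 1) * gen (n + (i + j)))"
    by (simp only: shift_deriv_gen shift_deriv_const_mult num_add_ac)
  ultimately have "shift_deriv i (shift_deriv j (gen n :: 'k witt_sym)) - shift_deriv j (shift_deriv i (gen n)) =
      const ((numeral (n + j) + 1) - (numeral (n + i) + 1)) * (const (numeral n + 1) * gen (n + (i + j)))"
    by (simp only: const_mult_diff)
  then show ?case
    unfolding numeral_diff_cancel shift_deriv_gen .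
next
  case (add f g)
  have "shift_deriv i (shift_deriv j (f + g)) - shift_deriv j (shift_deriv i (f + g)) =
      (shift_deriv i (shift_deriv j f) - shift_deriv j (shift_deriv i f)) + (shift_deriv i (shift_deriv j g) - shift_deriv j (shift_deriv i g))"
    by (simp only: shift_deriv_add add_diff_add)
  also have "\<dots> = const (numeral j - numeral i) * shift_deriv (i + j) (f + g)"
    unfolding add shift_deriv_add by (simp only: distrib_left)
  finally show ?case .
next
  case (mult f g)
  have "shift_deriv i (shift_deriv j (f * g)) - shift_deriv j (shift_deriv i (f * g)) =
      (shift_deriv i (shift_deriv j f) - shift_deriv j (shift_deriv i f)) * g + f * (shift_deriv i (shift_deriv j g) - shift_deriv j (shift_deriv i g))"
    by (simp add: shift_deriv_add shift_deriv_mult algebra_simps)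
  also have "\<dots> = const (numeral j - numeral i) * shift_deriv (i + j) (f * g)"
    unfolding mult shift_deriv_mult by (simp only: distrib_left ac_simps)
  finally show ?case .
qed

text \<open>Multiplications commute with each other, the derivations are covered by
  \<open>shift_deriv_commutator\<close>, and the mixed terms leave multiplication by
  \<open>(j + 1) - (i + 1)\<close> times \<open>gen (i + j)\<close>.\<close>

lemma act_gen_commutator:
  fixes s :: "'k::field_char_0 witt_sym"
  shows "act_gen i (act_gen j s) - act_gen j (act_gen i s) = const (numeral j - numeral i) * act_gen (i + j) s"
proof -
  have "act_gen i (act_gen j s) - act_gen j (act_gen i s) =
      (shift_deriv i (gen j) - shift_deriv j (gen i)) * s + (shift_deriv i (shift_deriv j s) - shift_deriv j (shift_deriv i s))"
    by (simp add: act_gen_def shift_deriv_add shift_deriv_mult algebra_simps)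
  moreover have "shift_deriv i (gen j :: 'k witt_sym) - shift_deriv j (gen i) = const (numeral j - numeral i) * gen (i + j)"
    by (simp only: shift_deriv_gen num_add_ac(2)[of j i] flip: left_diff_distrib single_diff)
      (simp only: add_diff_cancel_right)
  ultimately have "act_gen i (act_gen j s) - act_gen j (act_gen i s) =
      const (numeral j - numeral i) * gen (i + j) * s + const (numeral j - numeral i) * shift_deriv (i + j) s"
    by (simp only: shift_deriv_commutator)
  then show ?thesis
    by (simp only: act_gen_def[of "i + j"] distrib_left mult.assoc)
qed

lemma act_gen_add: "act_gen i (s + t) = act_gen i s + act_gen i t"
  by (simp add: act_gen_def shift_deriv_add algebra_simps)

lemma act_gen_const_mult: "act_gen i (const c * s) = const c * act_gen i s"
  by (simp only: act_gen_def shift_deriv_const_mult distrib_left mult.left_commute)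

section \<open>The action of the tensor algebra\<close>

definition act_word :: "num word \<Rightarrow> 'k::field_char_0 witt_sym \<Rightarrow> 'k witt_sym" where
  "act_word w s = foldr act_gen (letters w) s"

lemma act_word_plus: "act_word (v + w) s = act_word v (act_word w s)"
  by (simp add: act_word_def plus_word_def)

lemma act_word_Word [simp]:
  "act_word (Word []) s = s" "act_word (Word (i # l)) s = act_gen i (act_word (Word l) s)"
  by (simp_all add: act_word_def)

lemma act_word_add: "act_word w (s + t) = act_word w s + act_word w t"
proof (cases w)
  case (Word l)
  show ?thesis
    unfolding Word by (induction l) (simp_all add: act_gen_add)
qed

lemma act_word_const_mult: "act_word w (const c * s) = const c * act_word w s"
proof (cases w)
  case (Word l)
  show ?thesis
    unfolding Word by (induction l) (simp_all add: act_gen_const_mult)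
qed

definition act :: "'k::field_char_0 witt_tensor \<Rightarrow> 'k witt_sym \<Rightarrow> 'k witt_sym" where
  "act t s = lin (\<lambda>w. act_word w s) t"

lemma act_add_left: "act (t + u) s = act t s + act u s"
  by (simp add: act_def lin_add)

lemma act_diff_left: "act (t - u) s = act t s - act u s"
  by (simp add: act_def lin_diff)

lemma act_zero_left [simp]: "act 0 s = 0"
  by (simp add: act_def)

lemma act_single: "act (single w c) s = const c * act_word w s"
  by (simp add: act_def)

lemma act_add_right: "act t (s + s') = act t s + act t s'"
  by (induction t rule: poly_mapping_induct)
    (simp_all add: act_add_left act_single act_word_add algebra_simps)

lemma act_const_mult_right: "act t (const c * s) = const c * act t s"
  by (induction t rule: poly_mapping_induct)
    (simp_all add: act_add_left act_single act_word_const_mult distrib_left mult.left_commute[of "const c"])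

lemma act_zero_right [simp]: "act t 0 = 0"
  using act_const_mult_right[of t 0 0] by simp

lemma act_mult: "act (t * u) s = act t (act u s)"
proof (induction t rule: poly_mapping_induct)
  case (single v c)
  show ?case
  proof (induction u rule: poly_mapping_induct)
    case (single w d)
    then show ?case
      by (simp only: mult_single[of v c w d] act_single act_word_plus act_word_const_mult const_mult mult.assoc)
  qed (simp_all add: distrib_left act_add_left act_add_right)
qed (simp_all add: distrib_right act_add_left)

lemma tensor_of_eq_lin: "tensor_of x = lin (\<lambda>i. single (Word [i]) 1) x"
  by (simp add: tensor_of_def lin_def mult_single)

lemma tensor_of_add: "tensor_of (x + y) = tensor_of x + tensor_of y"
  by (simp add: tensor_of_eq_lin lin_add)

lemma tensor_of_sum: "tensor_of (\<Sum>i\<in>A. f i) = (\<Sum>i\<in>A. tensor_of (f i))"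
proof -
  have "tensor_of 0 = (0 :: 'a witt_tensor)"
    by (simp add: tensor_of_eq_lin)
  then show ?thesis
    by (induction A rule: infinite_finite_induct) (simp_all add: tensor_of_add)
qed

lemma tensor_of_single: "tensor_of (single i c) = single (Word [i]) c"
  by (simp add: tensor_of_eq_lin mult_single)

lemma act_sum_left: "act (\<Sum>i\<in>A. f i) s = (\<Sum>i\<in>A. act (f i) s)"
  by (induction A rule: infinite_finite_induct) (simp_all add: act_add_left)

lemma act_sum_right: "act t (\<Sum>i\<in>A. f i) = (\<Sum>i\<in>A. act t (f i))"
  by (induction A rule: infinite_finite_induct) (simp_all add: act_add_right)

lemma act_tensor_of: "act (tensor_of x) s = (\<Sum>i\<in>keys x. const (lookup x i) * act_gen i s)"
  by (simp add: tensor_of_def act_sum_left act_single)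

lemma act_tensor_of_mult:
  "act (tensor_of x * tensor_of y) s =
    (\<Sum>i\<in>keys x. \<Sum>j\<in>keys y. const (lookup x i * lookup y j) * act_gen i (act_gen j s))"
proof -
  have "act (tensor_of x * tensor_of y) s =
      (\<Sum>j\<in>keys y. const (lookup y j) * (\<Sum>i\<in>keys x. const (lookup x i) * act_gen i (act_gen j s)))"
    unfolding act_mult act_tensor_of[of y] act_sum_right act_const_mult_right act_tensor_of ..
  also have "\<dots> = (\<Sum>j\<in>keys y. \<Sum>i\<in>keys x. const (lookup x i * lookup y j) * act_gen i (act_gen j s))"
    by (simp only: sum_distrib_left const_mult ac_simps)
  also have "\<dots> = (\<Sum>i\<in>keys x. \<Sum>j\<in>keys y. const (lookup x i * lookup y j) * act_gen i (act_gen j s))"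
    by (rule sum.swap)
  finally show ?thesis .
qed

lemma act_bracket:
  "act (tensor_of x * tensor_of y - tensor_of y * tensor_of x - tensor_of (witt_bracket x y)) s = 0"
proof -
  have "act (tensor_of y * tensor_of x) s =
      (\<Sum>i\<in>keys x. \<Sum>j\<in>keys y. const (lookup x i * lookup y j) * act_gen j (act_gen i s))"
    unfolding act_tensor_of_mult by (subst sum.swap) (simp only: mult.commute)
  moreover have "act (tensor_of (witt_bracket x y)) s =
      (\<Sum>i\<in>keys x. \<Sum>j\<in>keys y. const (lookup x i * lookup y j) *
        (const (numeral j - numeral i) * act_gen (i + j) s))"
    unfolding witt_bracket_def tensor_of_sum tensor_of_single act_sum_left act_single act_word_Word
      const_mult mult.assoc ..
  ultimately show ?thesis
    by (simp only: act_diff_left act_tensor_of_mult act_gen_commutator[symmetric] right_diff_distrib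
        sum_subtractf diff_self)
qed

subsection \<open>Ideals of type-class rings\<close>

lemma ring_of_type_algebra_simps [simp]:
  "carrier ring_of_type_algebra = UNIV" "x \<otimes>\<^bsub>ring_of_type_algebra\<^esub> y = x * y"
  "x \<oplus>\<^bsub>ring_of_type_algebra\<^esub> y = x + y" "\<zero>\<^bsub>ring_of_type_algebra\<^esub> = 0"
  "\<one>\<^bsub>ring_of_type_algebra\<^esub> = 1"
  by (simp_all add: ring_of_type_algebra_def)

lemma ring_of_type_algebra_ring: "ring (ring_of_type_algebra :: 'a::ring_1 ring)"
proof -
  have "\<exists>y. x + y = 0" for x :: 'a
    by (rule exI[of _ "- x"]) simp
  then show ?thesis
    unfolding ring_of_type_algebra_def
    by unfold_locales (auto simp: algebra_simps Units_def add_eq_0_iff)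
qed

lemma ideal_ring_of_type_algebra_iff:
  "ideal I (ring_of_type_algebra :: 'a::ring_1 ring) \<longleftrightarrow>
    0 \<in> I \<and> (\<forall>x\<in>I. \<forall>y\<in>I. x + y \<in> I) \<and> (\<forall>a. \<forall>x\<in>I. a * x \<in> I \<and> x * a \<in> I)"
  (is "ideal I ?R \<longleftrightarrow> ?P")
proof
  assume I: "ideal I ?R"
  then have sub: "additive_subgroup I ?R"
    by (simp add: ideal_def)
  show ?P
    using additive_subgroup.zero_closed[OF sub] additive_subgroup.a_closed[OF sub]
      ideal.I_l_closed[OF I] ideal.I_r_closed[OF I] by simp
next
  assume P: ?P
  interpret R: ring ?R by (rule ring_of_type_algebra_ring)
  have "inv\<^bsub>add_monoid ?R\<^esub> x = - x" for x
    using R.minus_equality[of "- x" x] by (simp add: a_inv_def)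
  moreover have "- x \<in> I" if "x \<in> I" for x
    using P that by (metis mult_minus1)
  ultimately have "subgroup I (add_monoid ?R)"
    using P by unfold_locales auto
  then show "ideal I ?R"
    using P by (intro idealI R.ring_axioms) auto
qed

lemma genideal_ring_of_type_algebra:
  fixes A :: "'a::ring_1 set"
  shows "A \<subseteq> Idl\<^bsub>ring_of_type_algebra\<^esub> A"
    and "ideal (Idl\<^bsub>ring_of_type_algebra\<^esub> A) ring_of_type_algebra"
    and "ideal I ring_of_type_algebra \<Longrightarrow> A \<subseteq> I \<Longrightarrow> Idl\<^bsub>ring_of_type_algebra\<^esub> A \<subseteq> I"
  using ring.genideal_self[OF ring_of_type_algebra_ring, of A]
    ring.genideal_ideal[OF ring_of_type_algebra_ring, of A]
    ring.genideal_minimal[OF ring_of_type_algebra_ring, of I A] by simp_all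

lemmas U_rel_ideal = ideal_U_rel[unfolded T_W_def ideal_ring_of_type_algebra_iff]

lemma U_rel_zero: "0 \<in> U_rel"
  using U_rel_ideal by (rule conjunct1)

lemma U_rel_add: "x \<in> U_rel \<Longrightarrow> y \<in> U_rel \<Longrightarrow> x + y \<in> U_rel"
  using U_rel_ideal by blast

lemma U_rel_mult_left: "x \<in> U_rel \<Longrightarrow> a * x \<in> U_rel"
  using U_rel_ideal by blast

lemma U_rel_mult_right: "x \<in> U_rel \<Longrightarrow> x * a \<in> U_rel"
  using U_rel_ideal by blast

lemma U_rel_bracket:
  "tensor_of x * tensor_of y - tensor_of y * tensor_of x - tensor_of (witt_bracket x y) \<in> U_rel"
  unfolding U_rel_def T_W_def by (rule subsetD[OF genideal_ring_of_type_algebra(1)]) blast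

text \<open>The tensors acting as zero form a two-sided ideal, which contains the defining relations
  by \<open>act_bracket\<close>; thus the action descends to the enveloping algebra.\<close>

lemma act_U_rel:
  fixes t :: "'k::field_char_0 witt_tensor"
  assumes "t \<in> U_rel"
  shows "act t s = 0"
proof -
  let ?I = "{t :: 'k witt_tensor. \<forall>s. act t s = 0}"
  have "ideal ?I (ring_of_type_algebra :: 'k witt_tensor ring)"
    unfolding ideal_ring_of_type_algebra_iff by (simp add: act_add_left act_mult)
  then have "U_rel \<subseteq> ?I"
    unfolding U_rel_def T_W_def
    by (rule genideal_ring_of_type_algebra(3)) (use act_bracket in blast)
  then show ?thesis
    using assms by blast
qed

subsection \<open>Symbols\<close>

definition content :: "num word \<Rightarrow> num \<Rightarrow>\<^sub>0 nat" where
  "content w = (\<Sum>i\<leftarrow>letters w. single i 1)"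

lemma content_simps [simp]:
  "content (Word []) = 0" "content (Word (i # l)) = single i 1 + content (Word l)"
  by (simp_all add: content_def)

definition mdeg :: "(num \<Rightarrow>\<^sub>0 nat) \<Rightarrow> nat" where
  "mdeg a = (\<Sum>i\<in>keys a. lookup a i)"

lemma mdeg_superset: "finite A \<Longrightarrow> keys a \<subseteq> A \<Longrightarrow> mdeg a = (\<Sum>i\<in>A. lookup a i)"
  unfolding mdeg_def by (intro sum.mono_neutral_left) (auto simp: in_keys_iff)

lemma mdeg_add: "mdeg (a + b) = mdeg a + mdeg b"
proof -
  let ?A = "keys a \<union> keys b"
  have "mdeg (a + b) = (\<Sum>i\<in>?A. lookup (a + b) i)"
    using Poly_Mapping.keys_add[of a b] by (intro mdeg_superset) auto
  moreover have "mdeg a = (\<Sum>i\<in>?A. lookup a i)" "mdeg b = (\<Sum>i\<in>?A. lookup b i)"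
    by (intro mdeg_superset; simp)+
  ultimately show ?thesis
    by (simp add: lookup_add sum.distrib)
qed

lemma mdeg_zero [simp]: "mdeg 0 = 0"
  by (simp add: mdeg_def)

lemma mdeg_single [simp]: "mdeg (single i n) = n"
  by (simp add: mdeg_def)

lemma mdeg_content: "mdeg (content w) = length (letters w)"
proof (cases w)
  case (Word l)
  show ?thesis
    unfolding Word by (induction l) (simp_all add: mdeg_add)
qed

lemma mdeg_minus_single: "lookup a i \<noteq> 0 \<Longrightarrow> mdeg a = Suc (mdeg (a - single i 1))"
proof -
  assume "lookup a i \<noteq> 0"
  then have "a = a - single i 1 + single i 1"
    by (intro poly_mapping_eqI) (auto simp: lookup_minus lookup_add lookup_single when_def)
  then have "mdeg a = mdeg (a - single i 1 + single i 1)"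
    by simp
  then show ?thesis
    by (simp add: mdeg_add)
qed

definition sym_low :: "nat \<Rightarrow> 'k::field_char_0 witt_sym set" where
  "sym_low n = {s. \<forall>a\<in>keys s. mdeg a < n}"

lemma sym_low_zero [simp]: "0 \<in> sym_low n"
  by (simp add: sym_low_def)

lemma sym_low_mono: "s \<in> sym_low m \<Longrightarrow> m \<le> n \<Longrightarrow> s \<in> sym_low n"
  by (auto simp: sym_low_def)

lemma sym_low_single: "mdeg a < n \<Longrightarrow> single a c \<in> sym_low n"
  by (simp add: sym_low_def)

lemma sym_low_add: "s \<in> sym_low n \<Longrightarrow> t \<in> sym_low n \<Longrightarrow> s + t \<in> sym_low n"
  using Poly_Mapping.keys_add[of s t] by (fastforce simp: sym_low_def)

lemma sym_low_sum: "(\<And>i. i \<in> A \<Longrightarrow> f i \<in> sym_low n) \<Longrightarrow> (\<Sum>i\<in>A. f i) \<in> sym_low n"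
  by (induction A rule: infinite_finite_induct) (auto intro: sym_low_add)

lemma sym_low_const_mult: "s \<in> sym_low n \<Longrightarrow> const c * s \<in> sym_low n"
  by (auto simp: sym_low_def in_keys_iff lookup_const_mult)

lemma sym_low_gen_mult:
  assumes "s \<in> sym_low n"
  shows "gen i * s \<in> sym_low (Suc n)"
proof -
  have "\<exists>b\<in>keys s. a = single i 1 + b" if "a \<in> keys (gen i * s)" for a
    using Poly_Mapping.keys_mult[of "gen i :: 'a witt_sym" s] that by auto
  then show ?thesis
    using assms by (fastforce simp: sym_low_def mdeg_add)
qed

lemma sym_low_shift_deriv:
  fixes s :: "'k::field_char_0 witt_sym"
  assumes "s \<in> sym_low n"
  shows "shift_deriv j s \<in> sym_low n"
proof (rule poly_mapping_keys_induct[of "\<lambda>s. shift_deriv j s \<in> sym_low n" s])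
  fix a and c :: 'k assume "a \<in> keys s"
  then have a: "mdeg a < n"
    using assms by (auto simp: sym_low_def)
  show "shift_deriv j (single a c) \<in> sym_low n"
    unfolding shift_deriv_def sym_deriv_def lin_single mult_single
  proof (intro sym_low_const_mult sym_low_sum sym_low_single)
    fix i assume "i \<in> keys a"
    then show "mdeg (a - single i 1 + single (i + j) 1) < n"
      using a mdeg_minus_single[of a i] by (simp add: mdeg_add in_keys_iff)
  qed
qed (simp_all add: shift_deriv_add sym_low_add)

text \<open>In \<open>act_gen\<close> the multiplication raises the degree by one and the derivation
  does not raise it. Hence the top part of the action on 1 only sees the commutative monomial of the
  word.\<close>

lemma act_word_one: "act_word w 1 - monom_of (content w) \<in> sym_low (length (letters w))"
proof (cases w)
  case (Word l)
  have "act_word (Word l) 1 - monom_of (content (Word l)) \<in> (sym_low (length l) :: 'a witt_sym set)"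
  proof (induction l)
    case Nil
    then show ?case by simp
  next
    case (Cons i l)
    let ?u = "act_word (Word l) 1 :: 'a witt_sym" and ?m = "monom_of (content (Word l)) :: 'a witt_sym"
    have "?m \<in> sym_low (Suc (length l))"
      by (intro sym_low_single) (simp add: mdeg_content)
    then have "?u - ?m + ?m \<in> sym_low (Suc (length l))"
      using Cons by (intro sym_low_add) (auto intro: sym_low_mono)
    then have "gen i * (?u - ?m) + shift_deriv i ?u \<in> sym_low (Suc (length l))"
      using Cons by (intro sym_low_add sym_low_gen_mult sym_low_shift_deriv) simp_all
    moreover have "act_word (Word (i # l)) 1 - monom_of (content (Word (i # l))) =
        gen i * (?u - ?m) + shift_deriv i ?u"
      by (simp add: act_gen_def right_diff_distrib mult_single)
    ultimately show ?case
      by simp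
  qed
  then show ?thesis
    by (simp add: Word)
qed

lemma sym_component_eq_lin:
  "sym_component n t = lin (\<lambda>w. if length (letters w) = n then monom_of (content w) else 0) t"
proof -
  have "sym_component n t =
      (\<Sum>w\<in>keys t. if length (letters w) = n then single (content w) (lookup t w) else 0)"
    unfolding sym_component_def content_def by (rule sum.inter_filter) simp
  also have "\<dots> = lin (\<lambda>w. if length (letters w) = n then monom_of (content w) else 0) t"
    unfolding lin_def by (intro sum.cong refl) (simp add: mult_single)
  finally show ?thesis .
qed

lemma sym_component_zero [simp]: "sym_component n 0 = 0"
  and sym_component_add: "sym_component n (t + u) = sym_component n t + sym_component n u"
  and sym_component_diff: "sym_component n (t - u) = sym_component n t - sym_component n u"
  and sym_component_const_mult: "sym_component n (const c * t) = const c * sym_component n t"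
  and sym_component_single: "sym_component n (single w c) =
    (if length (letters w) = n then single (content w) c else 0)"
  by (simp_all add: sym_component_eq_lin lin_add lin_diff lin_const_mult mult_single)

lemma tensor_filtration_zero [simp]: "0 \<in> tensor_filtration n"
  by (simp add: tensor_filtration_def)

lemma tensor_filtration_mono: "t \<in> tensor_filtration m \<Longrightarrow> m \<le> n \<Longrightarrow> t \<in> tensor_filtration n"
  by (auto simp: tensor_filtration_def)

lemma tensor_filtration_add:
  "t \<in> tensor_filtration n \<Longrightarrow> u \<in> tensor_filtration n \<Longrightarrow> t + u \<in> tensor_filtration n"
  using Poly_Mapping.keys_add[of t u] by (fastforce simp: tensor_filtration_def)

lemma tensor_filtration_diff:
  "t \<in> tensor_filtration n \<Longrightarrow> u \<in> tensor_filtration n \<Longrightarrow> t - u \<in> tensor_filtration n"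
  using keys_diff[of t u] by (fastforce simp: tensor_filtration_def)

lemma tensor_filtration_single: "length (letters w) \<le> n \<Longrightarrow> single w c \<in> tensor_filtration n"
  by (simp add: tensor_filtration_def)

lemma tensor_filtration_const_mult: "t \<in> tensor_filtration n \<Longrightarrow> const c * t \<in> tensor_filtration n"
  by (auto simp: tensor_filtration_def in_keys_iff lookup_const_mult)

lemma tensor_filtration_induct [consumes 1, case_names zero single add]:
  assumes "t \<in> tensor_filtration n" "P 0"
    "\<And>w c. length (letters w) \<le> n \<Longrightarrow> P (single w c)"
    "\<And>t u. P t \<Longrightarrow> P u \<Longrightarrow> P (t + u)"
  shows "P t"
  using assms by (intro poly_mapping_keys_induct[of P t]) (auto simp: tensor_filtration_def)

lemma sym_component_filtration_less:
  "t \<in> tensor_filtration m \<Longrightarrow> m < n \<Longrightarrow> sym_component n t = 0"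
  by (induction t rule: tensor_filtration_induct) (auto simp: sym_component_single sym_component_add)

lemma keys_sym_component: "a \<in> keys (sym_component n t) \<Longrightarrow> mdeg a = n"
proof (induction t rule: poly_mapping_induct)
  case (add t u)
  then show ?case
    using Poly_Mapping.keys_add[of "sym_component n t" "sym_component n u"]
    by (auto simp: sym_component_add)
qed (auto simp: sym_component_single mdeg_content split: if_splits)

text \<open>The top component of a tensor can be read off from its action on 1. Since
  \<open>U_rel\<close> acts by zero, this will force the top component of a relation to
  vanish.\<close>

lemma act_one_filtration:
  fixes t :: "'k::field_char_0 witt_tensor"
  shows "t \<in> tensor_filtration n \<Longrightarrow> act t 1 - sym_component n t \<in> sym_low n"
proof (induction t rule: tensor_filtration_induct)
  case (single w c)
  have low: "act_word w 1 - monom_of (content w) \<in> (sym_low n :: 'k witt_sym set)"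
    using act_word_one single by (rule sym_low_mono)
  show ?case
  proof (cases "length (letters w) = n")
    case True
    then have "act (single w c) 1 - sym_component n (single w c) =
        const c * (act_word w 1 - monom_of (content w))"
      by (simp add: act_single sym_component_single right_diff_distrib mult_single)
    then show ?thesis
      using sym_low_const_mult[OF low] by simp
  next
    case False
    then have "monom_of (content w) \<in> (sym_low n :: 'k witt_sym set)"
      using single by (intro sym_low_single) (simp add: mdeg_content)
    with low
    have "act_word w 1 - monom_of (content w) + monom_of (content w) \<in> (sym_low n :: 'k witt_sym set)"
      by (rule sym_low_add)
    then show ?thesis
      using False by (simp add: act_single sym_component_single sym_low_const_mult)
  qed
next
  case (add t u)
  have "act (t + u) 1 - sym_component n (t + u) =
      (act t 1 - sym_component n t) + (act u 1 - sym_component n u)"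
    by (simp add: act_add_left sym_component_add)
  then show ?case
    using sym_low_add[OF add] by simp
qed simp

text \<open>The part of the Poincare--Birkhoff--Witt theorem that makes leading symbols well defined.\<close>

lemma sym_component_U_rel:
  assumes "t \<in> U_rel" "t \<in> tensor_filtration n"
  shows "sym_component n t = 0"
proof -
  have low: "- sym_component n t \<in> sym_low n"
    using act_one_filtration[OF assms(2)] act_U_rel[OF assms(1)] by simp
  show ?thesis
  proof (rule poly_mapping_eqI)
    fix a
    show "lookup (sym_component n t) a = lookup 0 a"
    proof (rule ccontr)
      assume "lookup (sym_component n t) a \<noteq> lookup 0 a"
      then have "a \<in> keys (sym_component n t)" "a \<in> keys (- sym_component n t)"
        by (simp_all add: in_keys_iff)
      then show False
        using low keys_sym_component[of a n t] by (auto simp: sym_low_def)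
    qed
  qed
qed

lemma U_rel_uminus: "x \<in> U_rel \<Longrightarrow> - x \<in> U_rel"
  using U_rel_mult_left[of x "- 1"] by simp

subsection \<open>Commutation of words\<close>

lemma single_Word_mult: "single (Word l) c * single (Word l') d = single (Word (l @ l')) (c * d)"
  by (simp add: mult_single plus_word_def)

lemma U_rel_commute_letters:
  "single (Word (i # j # l)) 1 - single (Word (j # i # l)) 1 -
    single (Word ((i + j) # l)) (numeral j - numeral i :: 'k::field_char_0) \<in> U_rel"
proof -
  have "single (Word [i]) (1::'k) * single (Word [j]) 1 - single (Word [j]) 1 * single (Word [i]) 1 -
      single (Word [i + j]) (numeral j - numeral i) \<in> U_rel"
    using U_rel_bracket[of "single i (1::'k)" "single j 1"]
    unfolding tensor_of_single witt_bracket_basis .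
  then have "(single (Word [i]) (1::'k) * single (Word [j]) 1 - single (Word [j]) 1 * single (Word [i]) 1 -
      single (Word [i + j]) (numeral j - numeral i)) * single (Word l) 1 \<in> U_rel"
    by (rule U_rel_mult_right)
  then show ?thesis
    by (simp only: left_diff_distrib single_Word_mult append.simps mult_1 mult_1_right)
qed

text \<open>The preimage in the tensor algebra of the elements of order less than \<open>n\<close>.
  The bound is strict so that \<open>tensor_low 0\<close> is \<open>U_rel\<close>.\<close>

definition tensor_low :: "nat \<Rightarrow> 'k::field_char_0 witt_tensor set" where
  "tensor_low n = {t. \<exists>u. (\<forall>w\<in>keys u. length (letters w) < n) \<and> t - u \<in> U_rel}"

lemma tensor_low_U_rel: "t \<in> U_rel \<Longrightarrow> t \<in> tensor_low n"
  unfolding tensor_low_def by (intro CollectI exI[of _ 0]) simp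

lemma tensor_low_single: "length (letters w) < n \<Longrightarrow> single w c \<in> tensor_low n"
  unfolding tensor_low_def by (intro CollectI exI[of _ "single w c"]) (simp add: U_rel_zero)

lemma tensor_low_add:
  assumes "t \<in> tensor_low n" "u \<in> tensor_low n"
  shows "t + u \<in> tensor_low n"
proof -
  obtain t' u' where *: "\<And>w. w \<in> keys t' \<Longrightarrow> length (letters w) < n" "t - t' \<in> U_rel"
    "\<And>w. w \<in> keys u' \<Longrightarrow> length (letters w) < n" "u - u' \<in> U_rel"
    using assms unfolding tensor_low_def by blast
  have "t + u - (t' + u') \<in> U_rel"
    using U_rel_add[OF *(2,4)] by (simp add: algebra_simps)
  moreover have "length (letters w) < n" if "w \<in> keys (t' + u')" for w
    using that *(1,3) Poly_Mapping.keys_add[of t' u'] by blast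
  ultimately show ?thesis
    unfolding tensor_low_def by blast
qed

lemma tensor_low_const_mult:
  assumes "t \<in> tensor_low n"
  shows "const c * t \<in> tensor_low n"
proof -
  obtain t' where *: "\<And>w. w \<in> keys t' \<Longrightarrow> length (letters w) < n" "t - t' \<in> U_rel"
    using assms unfolding tensor_low_def by blast
  have "const c * t - const c * t' \<in> U_rel"
    using U_rel_mult_left[OF *(2), of "const c"] by (simp add: right_diff_distrib)
  moreover have "length (letters w) < n" if "w \<in> keys (const c * t')" for w
    using that *(1)[of w] by (auto simp: in_keys_iff lookup_const_mult)
  ultimately show ?thesis
    unfolding tensor_low_def by blast
qed

lemma tensor_low_letter_mult:
  assumes "t \<in> tensor_low n"
  shows "single (Word [i]) 1 * t \<in> tensor_low (Suc n)"
proof -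
  let ?i = "single (Word [i]) 1 :: 'a witt_tensor"
  obtain t' where *: "\<And>w. w \<in> keys t' \<Longrightarrow> length (letters w) < n" "t - t' \<in> U_rel"
    using assms unfolding tensor_low_def by blast
  have "?i * t - ?i * t' \<in> U_rel"
    using U_rel_mult_left[OF *(2), of ?i] by (simp add: right_diff_distrib)
  moreover have "length (letters w) < Suc n" if w: "w \<in> keys (?i * t')" for w
  proof -
    obtain v where "v \<in> keys t'" "w = Word [i] + v"
      using w Poly_Mapping.keys_mult[of ?i t'] by auto
    then show ?thesis
      using *(1)[of v] by (simp add: plus_word_def)
  qed
  ultimately show ?thesis
    unfolding tensor_low_def by blast
qed

text \<open>The letter \<open>i\<close> passes the letters of \<open>p\<close> one at a time; each
  exchange costs a multiple of a word that is one letter shorter, namely \<open>?v\<close> in the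
  proof.\<close>

lemma tensor_low_move:
  "single (Word (p @ i # q)) 1 - single (Word (i # p @ q)) 1 \<in>
    (tensor_low (Suc (length p + length q)) :: 'k::field_char_0 witt_tensor set)"
proof (induction p)
  case Nil
  then show ?case
    by (simp add: tensor_low_U_rel U_rel_zero)
next
  case (Cons j p)
  let ?w = "\<lambda>l. single (Word l) 1 :: 'k witt_tensor"
  let ?n = "Suc (length (j # p) + length q)"
  let ?v = "single (Word ((j + i) # p @ q)) (numeral i - numeral j :: 'k)"
  have "?w [j] * (?w (p @ i # q) - ?w (i # p @ q)) \<in> tensor_low ?n"
    using tensor_low_letter_mult[OF Cons] by simp
  moreover have "?w (j # i # p @ q) - ?w (i # j # p @ q) - ?v \<in> tensor_low ?n"
    using U_rel_commute_letters by (rule tensor_low_U_rel)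
  moreover have "?v \<in> tensor_low ?n"
    by (rule tensor_low_single) simp
  ultimately have "?w [j] * (?w (p @ i # q) - ?w (i # p @ q)) +
      ((?w (j # i # p @ q) - ?w (i # j # p @ q) - ?v) + ?v) \<in> tensor_low ?n"
    by (intro tensor_low_add)
  then show ?case
    by (simp add: right_diff_distrib single_Word_mult)
qed

text \<open>The first letter of \<open>l\<close> is located in \<open>l'\<close> and moved to the
  front; the induction hypothesis handles the tails.\<close>

lemma tensor_low_permute:
  "mset l = mset l' \<Longrightarrow>
    single (Word l) 1 - single (Word l') 1 \<in> (tensor_low (length l) :: 'k::field_char_0 witt_tensor set)"
proof (induction l arbitrary: l')
  case Nil
  then show ?case
    by (simp add: tensor_low_U_rel U_rel_zero)
next
  case (Cons i l)
  let ?w = "\<lambda>l. single (Word l) 1 :: 'k witt_tensor"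
  have "i \<in> set l'"
    using Cons.prems by (metis list.set_intros(1) mset_eq_setD)
  then obtain p q where l': "l' = p @ i # q"
    by (meson split_list)
  then have pq: "mset l = mset (p @ q)"
    using Cons.prems by simp
  then have len: "length l = length p + length q"
    by (metis length_append size_mset)
  have "?w [i] * (?w l - ?w (p @ q)) \<in> tensor_low (length (i # l))"
    using tensor_low_letter_mult[OF Cons.IH[OF pq]] by simp
  moreover have "const (- 1) * (?w (p @ i # q) - ?w (i # p @ q)) \<in> tensor_low (length (i # l))"
    using tensor_low_const_mult[OF tensor_low_move[of p i q]] by (simp add: len)
  ultimately have "?w [i] * (?w l - ?w (p @ q)) + const (- 1) * (?w (p @ i # q) - ?w (i # p @ q))
      \<in> tensor_low (length (i # l))"
    by (rule tensor_low_add)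
  moreover have "const (- 1) = (- 1 :: 'k witt_tensor)"
    by (simp add: single_uminus)
  ultimately show ?case
    by (simp add: l' right_diff_distrib single_Word_mult)
qed

lemma lookup_content: "lookup (content (Word l)) i = count (mset l) i"
  by (induction l) (auto simp: lookup_add lookup_single when_def)

text \<open>An unspecified representative: what matters is that all words with the same content
  receive the same one.\<close>

definition normal_word :: "(num \<Rightarrow>\<^sub>0 nat) \<Rightarrow> num word" where
  "normal_word a = Word (SOME l. content (Word l) = a)"

lemma tensor_low_normal_word:
  "single w 1 - single (normal_word (content w)) 1 \<in> (tensor_low (length (letters w)) :: 'k::field_char_0 witt_tensor set)"
proof (cases w)
  case (Word l)
  let ?l = "SOME l'. content (Word l') = content (Word l)"
  have "content (Word ?l) = content (Word l)"
    by (rule someI) (rule refl)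
  then have "mset l = mset ?l"
    by (intro multiset_eqI) (metis lookup_content)
  then show ?thesis
    unfolding normal_word_def Word using tensor_low_permute[of l ?l] by simp
qed

lemma straighten:
  "t \<in> tensor_filtration n \<Longrightarrow>
    t - lin (\<lambda>a. single (normal_word a) 1) (sym_component n t) \<in> tensor_low n"
proof (induction t rule: tensor_filtration_induct)
  case zero
  then show ?case
    by (simp add: tensor_low_U_rel U_rel_zero)
next
  case (single w c)
  show ?case
  proof (cases "length (letters w) = n")
    case True
    have "const c * (single w 1 - single (normal_word (content w)) 1) \<in> tensor_low n"
      using tensor_low_const_mult[OF tensor_low_normal_word] True by metis
    then show ?thesis
      using True by (simp add: sym_component_single right_diff_distrib mult_single)
  next
    case False
    then show ?thesis
      using single by (simp add: sym_component_single tensor_low_single)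
  qed
next
  case (add t u)
  then show ?case
    using tensor_low_add[OF add] by (simp add: sym_component_add lin_add algebra_simps)
qed

text \<open>The counterpart of \<open>sym_component_U_rel\<close>: by straightening, a tensor is
  determined by its symbol up to lower order, so a vanishing symbol means a drop in order.\<close>

lemma sym_component_eq_zero:
  assumes "t \<in> tensor_filtration n" "sym_component n t = 0"
  shows "t \<in> tensor_low n"
  using straighten[OF assms(1)] assms(2) by simp

lemma sym_component_letter_mult:
  "sym_component (Suc n) (single (Word [i]) 1 * t) = gen i * sym_component n t"
proof (induction t rule: poly_mapping_induct)
  case (single w c)
  then show ?case
    by (cases w) (simp add: mult_single plus_word_def sym_component_single)
qed (simp_all add: distrib_left sym_component_add)

lemma tensor_filtration_letter_mult:
  assumes "t \<in> tensor_filtration n"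
  shows "single (Word [i]) 1 * t \<in> tensor_filtration (Suc n)"
  using assms
proof (induction t rule: tensor_filtration_induct)
  case (single w c)
  then show ?case
    by (cases w) (simp add: single_Word_mult tensor_filtration_single)
qed (simp_all add: distrib_left tensor_filtration_add)

subsection \<open>The derivation of the symmetric algebra given by the bracket with \<open>e\<^sub>1\<close>\<close>

definition ad_e1 :: "'k::field_char_0 witt_sym \<Rightarrow> 'k witt_sym" where
  "ad_e1 = sym_deriv (\<lambda>i. single (single (num.One + i) 1) (numeral i - 1))"

text \<open>The commutator with the first generator obeys the Leibniz rule on words, and modulo
  \<open>U_rel\<close> each bracket of two letters is a single letter. So the commutator has a
  representative \<open>u\<close> of the same length as the word, one less than the two products
  have.\<close>

lemma ad_e1_word:
  "\<exists>u\<in>tensor_filtration (length l).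
    single (Word [num.One]) 1 * single (Word l) 1 - single (Word l) 1 * single (Word [num.One]) 1 - u
      \<in> (U_rel :: 'k::field_char_0 witt_tensor set) \<and>
    sym_component (length l) u = ad_e1 (monom_of (content (Word l)))"
proof (induction l)
  case Nil
  then show ?case
    using sym_deriv_const[of _ 1]
    by (intro bexI[of _ 0]) (auto simp: single_Word_mult U_rel_zero ad_e1_def)
next
  case (Cons i l)
  let ?w = "\<lambda>l. single (Word l) 1 :: 'k witt_tensor"
  let ?v = "single (Word ((num.One + i) # l)) (numeral i - numeral num.One :: 'k)"
  obtain u where u: "u \<in> tensor_filtration (length l)"
    "?w [num.One] * ?w l - ?w l * ?w [num.One] - u \<in> U_rel"
    "sym_component (length l) u = ad_e1 (monom_of (content (Word l)))"
    using Cons by blast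
  have "?w (num.One # i # l) - ?w (i # num.One # l) - ?v + ?w [i] * (?w [num.One] * ?w l - ?w l * ?w [num.One] - u) \<in> U_rel"
    by (intro U_rel_add U_rel_commute_letters U_rel_mult_left u)
  then have "?w [num.One] * ?w (i # l) - ?w (i # l) * ?w [num.One] - (?v + ?w [i] * u) \<in> U_rel"
    by (simp add: right_diff_distrib single_Word_mult algebra_simps)
  moreover have "?v + ?w [i] * u \<in> tensor_filtration (length (i # l))"
    using tensor_filtration_letter_mult[OF u(1), of i]
    by (intro tensor_filtration_add tensor_filtration_single) simp_all
  moreover have "sym_component (length (i # l)) (?v + ?w [i] * u) = ad_e1 (monom_of (content (Word (i # l))))"
  proof -
    have "sym_component (length (i # l)) (?v + ?w [i] * u) =
        single (content (Word ((num.One + i) # l))) (numeral i - 1) + gen i * ad_e1 (monom_of (content (Word l)))"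
      by (simp add: sym_component_add sym_component_single sym_component_letter_mult u(3))
    also have "\<dots> = ad_e1 (gen i * monom_of (content (Word l)))"
      unfolding ad_e1_def sym_deriv_mult sym_deriv_e by (simp add: mult_single)
    finally show ?thesis
      by (simp add: mult_single)
  qed
  ultimately show ?case
    by blast
qed

lemma ad_e1_filtration:
  fixes t :: "'k::field_char_0 witt_tensor"
  assumes "t \<in> tensor_filtration n"
  shows "\<exists>u\<in>tensor_filtration n.
    single (Word [num.One]) 1 * t - t * single (Word [num.One]) 1 - u \<in> U_rel \<and>
    sym_component n u = ad_e1 (sym_component n t)"
  using assms
proof (induction t rule: tensor_filtration_induct)
  case zero
  show ?case
    by (intro bexI[of _ 0]) (auto simp: U_rel_zero ad_e1_def)
next
  case (single w c)
  obtain l where w: "w = Word l"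
    by (cases w)
  let ?e = "single (Word [num.One]) 1 :: 'k witt_tensor" and ?w = "single (Word l) 1 :: 'k witt_tensor"
  obtain u where u: "u \<in> tensor_filtration (length l)" "?e * ?w - ?w * ?e - u \<in> U_rel"
    "sym_component (length l) u = ad_e1 (monom_of (content (Word l)))"
    using ad_e1_word by blast
  have "const c * (?e * ?w - ?w * ?e - u) \<in> U_rel"
    by (intro U_rel_mult_left u)
  then have "?e * single w c - single w c * ?e - const c * u \<in> U_rel"
    by (simp add: w right_diff_distrib single_Word_mult mult_single)
  moreover have "const c * u \<in> tensor_filtration n"
    using u(1) single by (auto intro: tensor_filtration_const_mult tensor_filtration_mono simp: w)
  moreover have "sym_component n (const c * u) = ad_e1 (sym_component n (single w c))"
  proof (cases "length l = n")
    case True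
    then show ?thesis
      using u(3) single_eq_const_mult[of "content (Word l)" c]
      by (simp add: w sym_component_const_mult sym_component_single ad_e1_def sym_deriv_const_mult)
  next
    \<comment> \<open>A shorter word contributes nothing in degree \<open>n\<close>, and neither
      does its commutator, since \<open>u\<close> is no longer than the word.\<close>
    case False
    then have "sym_component n u = 0"
      using single u(1) by (intro sym_component_filtration_less) (auto simp: w)
    then show ?thesis
      using False by (simp add: w sym_component_const_mult sym_component_single ad_e1_def)
  qed
  ultimately show ?case
    by blast
next
  case (add t t')
  let ?e = "single (Word [num.One]) 1 :: 'k witt_tensor"
  obtain u u' where u: "u \<in> tensor_filtration n" "?e * t - t * ?e - u \<in> U_rel"
    "sym_component n u = ad_e1 (sym_component n t)"
    "u' \<in> tensor_filtration n" "?e * t' - t' * ?e - u' \<in> U_rel"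
    "sym_component n u' = ad_e1 (sym_component n t')"
    using add by blast
  have "?e * (t + t') - (t + t') * ?e - (u + u') \<in> U_rel"
    using U_rel_add[OF u(2,5)] by (simp add: algebra_simps)
  moreover have "sym_component n (u + u') = ad_e1 (sym_component n (t + t'))"
    using u by (simp add: sym_component_add ad_e1_def sym_deriv_add)
  ultimately show ?case
    using tensor_filtration_add u(1,4) by blast
qed

subsection \<open>Associated graded ideals\<close>

lemma U_class_eq_iff: "U_class t = U_class u \<longleftrightarrow> t - u \<in> U_rel"
proof -
  have coset: "U_class t = {x + t |x. x \<in> U_rel}" for t :: "'a witt_tensor"
    by (auto simp: U_class_def T_W_def a_r_coset_def r_coset_def)
  show ?thesis
  proof
    assume "U_class t = U_class u"
    then have "0 + t \<in> {x + u |x. x \<in> U_rel}"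
      using U_rel_zero unfolding coset by blast
    then show "t - u \<in> U_rel"
      by auto
  next
    assume tu: "t - u \<in> U_rel"
    have sub: "U_class t \<subseteq> U_class u" if "t - u \<in> U_rel" for t u :: "'a witt_tensor"
    proof
      fix y assume "y \<in> U_class t"
      then obtain x where "x \<in> U_rel" "y = (x + (t - u)) + u"
        unfolding coset by auto
      then show "y \<in> U_class u"
        using U_rel_add[OF _ that] unfolding coset by blast
    qed
    show "U_class t = U_class u"
      using sub[OF tu] sub[of u t] U_rel_uminus[OF tu] by simp
  qed
qed

lemma carrier_U_W: "carrier U_W = range U_class"
  by (auto simp: U_W_def FactRing_def A_RCOSETS_def RCOSETS_def U_class_def a_r_coset_def T_W_def)

lemma U_class_hom: "U_class \<in> ring_hom T_W U_W"
  using ideal.rcos_ring_hom[OF ideal_U_rel] by (simp add: U_class_def[abs_def] U_W_def)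

lemma U_class_mult: "U_class t \<otimes>\<^bsub>U_W\<^esub> U_class u = U_class (t * u)"
  using ring_hom_mult[OF U_class_hom, of t u] by (simp add: T_W_def)

lemma U_class_add: "U_class t \<oplus>\<^bsub>U_W\<^esub> U_class u = U_class (t + u)"
  using ring_hom_add[OF U_class_hom, of t u] by (simp add: T_W_def)

lemma U_class_zero: "\<zero>\<^bsub>U_W\<^esub> = U_class 0"
  using ring_hom_zero[OF U_class_hom ring_T_W ring_U_W]
  unfolding T_W_def ring_of_type_algebra_simps by (rule sym)

definition homogeneous :: "nat \<Rightarrow> 'k::field_char_0 witt_sym \<Rightarrow> 'k witt_sym" where
  "homogeneous n = lin (\<lambda>a. if mdeg a = n then monom_of a else 0)"

lemma homogeneous_zero [simp]: "homogeneous n 0 = 0"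
  by (simp add: homogeneous_def)

lemma homogeneous_add: "homogeneous n (s + t) = homogeneous n s + homogeneous n t"
  by (simp add: homogeneous_def lin_add)

lemma homogeneous_const_mult: "homogeneous n (const c * s) = const c * homogeneous n s"
  by (simp add: homogeneous_def lin_const_mult)

lemma homogeneous_single: "homogeneous n (single a c) = (if mdeg a = n then single a c else 0)"
  by (simp add: homogeneous_def mult_single)

lemma homogeneous_gen_mult:
  "homogeneous n (gen i * s) = (case n of 0 \<Rightarrow> 0 | Suc m \<Rightarrow> gen i * homogeneous m s)"
proof (induction s rule: poly_mapping_induct)
  case (single a c)
  then show ?case
    by (cases n) (simp_all add: mult_single homogeneous_single mdeg_add)
qed (cases n; simp add: distrib_left homogeneous_add)+

lemma homogeneous_sym_component:
  "homogeneous n (sym_component m t) = (if n = m then sym_component m t else 0)"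
  by (induction t rule: poly_mapping_induct)
    (simp_all add: sym_component_add homogeneous_add sym_component_single homogeneous_single mdeg_content)

text \<open>Ideals of the enveloping algebra are handled through their preimages in the tensor
  algebra, which avoids computing with cosets.\<close>

locale tensor_ideal =
  fixes K :: "'k::field_char_0 witt_tensor set"
  assumes U_rel_subset: "U_rel \<subseteq> K"
    and add_closed: "x \<in> K \<Longrightarrow> y \<in> K \<Longrightarrow> x + y \<in> K"
    and mult_left_closed: "x \<in> K \<Longrightarrow> a * x \<in> K"
    and mult_right_closed: "x \<in> K \<Longrightarrow> x * a \<in> K"
begin

lemma zero_closed: "0 \<in> K"
  using U_rel_subset U_rel_zero by blast

lemma diff_closed: "x \<in> K \<Longrightarrow> y \<in> K \<Longrightarrow> x - y \<in> K"
  using add_closed[of x "- 1 * y"] mult_left_closed[of y "- 1"] by simp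

text \<open>The degree \<open>n\<close> part of the associated graded ideal. Elements of order below
  \<open>n\<close> contribute zero, which makes this a linear subspace.\<close>

definition symbols :: "nat \<Rightarrow> 'k witt_sym set" where
  "symbols n = sym_component n ` (tensor_filtration n \<inter> K)"

lemma symbols_zero: "0 \<in> symbols n"
  unfolding symbols_def by (rule image_eqI[of _ _ 0]) (simp_all add: zero_closed)

lemma symbols_add: "s \<in> symbols n \<Longrightarrow> s' \<in> symbols n \<Longrightarrow> s + s' \<in> symbols n"
  unfolding symbols_def using tensor_filtration_add add_closed sym_component_add
  by (smt (verit, ccfv_threshold) IntE IntI image_iff)

lemma symbols_const_mult: "s \<in> symbols n \<Longrightarrow> const c * s \<in> symbols n"
  unfolding symbols_def using tensor_filtration_const_mult mult_left_closed sym_component_const_mult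
  by (smt (verit, ccfv_threshold) IntE IntI image_iff)

lemma symbols_gen_mult: "s \<in> symbols n \<Longrightarrow> gen i * s \<in> symbols (Suc n)"
  unfolding symbols_def using tensor_filtration_letter_mult mult_left_closed sym_component_letter_mult
  by (smt (verit, ccfv_threshold) IntE IntI image_iff)

text \<open>This ideal contains all symbols, hence all of \<open>graded\<close>. It follows that
  generating an ideal creates no new homogeneous elements, which is
  \<open>sym_component_in_graded\<close>.\<close>

lemma ideal_homogeneous_symbols:
  "ideal {s. \<forall>n. homogeneous n s \<in> symbols n} (ring_of_type_algebra :: 'k witt_sym ring)"
proof -
  let ?G = "{s. \<forall>n. homogeneous n s \<in> symbols n}"
  have closed: "\<forall>s\<in>?G. a * s \<in> ?G" for a
  proof (induction a rule: sym_induct)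
    case (const c)
    then show ?case
      by (simp add: homogeneous_const_mult symbols_const_mult)
  next
    case (gen i)
    show ?case
    proof (intro ballI CollectI allI)
      fix s n assume "s \<in> ?G"
      then show "homogeneous n (gen i * s) \<in> symbols n"
        unfolding homogeneous_gen_mult
        by (cases n) (simp_all add: symbols_zero symbols_gen_mult del: One_nat_def)
    qed
  next
    case (add f g)
    show ?case
    proof (intro ballI CollectI allI)
      fix s n assume "s \<in> ?G"
      then have "homogeneous n (f * s) \<in> symbols n" "homogeneous n (g * s) \<in> symbols n"
        using add by blast+
      then show "homogeneous n ((f + g) * s) \<in> symbols n"
        by (simp add: distrib_right homogeneous_add symbols_add)
    qed
  next
    case (mult f g)
    show ?case
    proof
      fix s assume "s \<in> ?G"
      then have "f * (g * s) \<in> ?G"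
        using mult by blast
      then show "f * g * s \<in> ?G"
        by (simp only: mult.assoc)
    qed
  qed
  show ?thesis
    unfolding ideal_ring_of_type_algebra_iff
  proof (intro conjI allI ballI)
    show "0 \<in> ?G"
      by (simp add: symbols_zero)
  next
    fix x y assume "x \<in> ?G" "y \<in> ?G"
    then show "x + y \<in> ?G"
      by (simp add: homogeneous_add symbols_add)
  next
    fix a x assume "x \<in> ?G"
    then show "a * x \<in> ?G"
      using closed by blast
    then show "x * a \<in> ?G"
      by (simp only: mult.commute[of x a])
  qed
qed

definition graded :: "'k witt_sym set" where
  "graded = Idl\<^bsub>ring_of_type_algebra\<^esub> (\<Union>n. symbols n)"

lemma symbols_subset_graded: "symbols n \<subseteq> graded"
  unfolding graded_def by (rule order_trans[OF _ genideal_ring_of_type_algebra(1)]) blast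

lemma sym_component_in_graded:
  assumes "sym_component n t \<in> graded"
  shows "sym_component n t \<in> symbols n"
proof -
  have "(\<Union>n. symbols n) \<subseteq> {s. \<forall>n. homogeneous n s \<in> symbols n}"
    by (auto simp: symbols_def[of n for n] homogeneous_sym_component intro: symbols_zero[unfolded symbols_def])
  then have "graded \<subseteq> {s. \<forall>n. homogeneous n s \<in> symbols n}"
    unfolding graded_def using ideal_homogeneous_symbols by (intro genideal_ring_of_type_algebra(3))
  then have "homogeneous n (sym_component n t) \<in> symbols n"
    using assms by blast
  then show ?thesis
    by (simp add: homogeneous_sym_component)
qed

text \<open>The commutator of \<open>t\<close> with the first generator lies in the two-sided ideal
  \<open>K\<close>; so does its representative \<open>u\<close> from
  \<open>ad_e1_filtration\<close>, as the two differ by an element of \<open>U_rel\<close>.\<close>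

lemma ad_e1_symbols: "s \<in> symbols n \<Longrightarrow> ad_e1 s \<in> symbols n"
proof -
  assume "s \<in> symbols n"
  then obtain t where t: "t \<in> tensor_filtration n" "t \<in> K" "s = sym_component n t"
    unfolding symbols_def by blast
  let ?e = "single (Word [num.One]) 1 :: 'k witt_tensor"
  obtain u where u: "u \<in> tensor_filtration n" "?e * t - t * ?e - u \<in> U_rel"
    "sym_component n u = ad_e1 s"
    using ad_e1_filtration[OF t(1)] t(3) by blast
  have "?e * t - t * ?e - (?e * t - t * ?e - u) \<in> K"
    by (rule diff_closed[OF diff_closed[OF mult_left_closed[OF t(2)] mult_right_closed[OF t(2)]]
        subsetD[OF U_rel_subset u(2)]])
  then show "ad_e1 s \<in> symbols n"
    using u unfolding symbols_def by (intro image_eqI[of _ _ u]) simp_all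
qed

text \<open>By the Leibniz rule, the elements of \<open>graded\<close> that \<open>ad_e1\<close>
  keeps in \<open>graded\<close> form an ideal, so stability on the generating symbols is
  enough.\<close>

lemma ad_e1_graded:
  assumes "s \<in> graded"
  shows "ad_e1 s \<in> graded"
proof -
  have graded: "ideal graded ring_of_type_algebra" "(\<Union>n. symbols n) \<subseteq> graded"
    unfolding graded_def by (rule genideal_ring_of_type_algebra)+
  have "ideal {s \<in> graded. ad_e1 s \<in> graded} ring_of_type_algebra"
    using graded(1) unfolding ideal_ring_of_type_algebra_iff ad_e1_def
    by (simp add: sym_deriv_add sym_deriv_mult)
  moreover have "(\<Union>n. symbols n) \<subseteq> {s \<in> graded. ad_e1 s \<in> graded}"
    using graded(2) ad_e1_symbols by blast
  ultimately have "graded \<subseteq> {s \<in> graded. ad_e1 s \<in> graded}"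
    unfolding graded_def[of] by (rule genideal_ring_of_type_algebra(3)[folded graded_def])
  then show ?thesis
    using assms by blast
qed

end

text \<open>Induction on the order: an element \<open>t\<close> of \<open>K'\<close> has the same
  symbol as some \<open>u\<close> in \<open>K\<close>, so \<open>t - u\<close> is congruent modulo
  \<open>U_rel\<close> to some \<open>v\<close> of lower order, and \<open>v\<close> again lies in
  \<open>K'\<close>.\<close>

lemma tensor_ideal_eq:
  assumes "tensor_ideal K" "tensor_ideal K'" "K \<subseteq> K'"
    and "tensor_ideal.graded K' \<subseteq> tensor_ideal.graded K"
  shows "K' \<subseteq> K"
proof -
  interpret K: tensor_ideal K by fact
  interpret K': tensor_ideal K' by fact
  have main: "t \<in> K" if "t \<in> tensor_filtration n" "t \<in> K'" for n t
    using that
  proof (induction n arbitrary: t rule: less_induct)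
    case (less n t)
    have "sym_component n t \<in> K'.symbols n"
      using less.prems unfolding K'.symbols_def by blast
    then have "sym_component n t \<in> K.graded"
      using assms(4) K'.symbols_subset_graded[of n] by blast
    then obtain u where u: "u \<in> tensor_filtration n" "u \<in> K" "sym_component n t = sym_component n u"
      using K.sym_component_in_graded unfolding K.symbols_def by blast
    then have "t - u \<in> tensor_low n"
      using less.prems(1)
      by (intro sym_component_eq_zero) (simp_all add: tensor_filtration_diff sym_component_diff)
    then obtain v where v: "\<And>w. w \<in> keys v \<Longrightarrow> length (letters w) < n" "t - u - v \<in> U_rel"
      unfolding tensor_low_def by blast
    have "t - u - (t - u - v) \<in> K'"
      by (rule K'.diff_closed[OF K'.diff_closed[OF less.prems(2) subsetD[OF assms(3) u(2)]]
          subsetD[OF K'.U_rel_subset v(2)]])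
    then have v': "v \<in> K'"
      by simp
    have vK: "v \<in> K"
    proof (cases n)
      case 0
      then have "keys v = {}"
        using v(1) by blast
      then have "v = 0"
        by simp
      then show ?thesis
        by (simp add: K.zero_closed)
    next
      case (Suc m)
      then have "v \<in> tensor_filtration m"
        using v(1) by (auto simp: tensor_filtration_def less_Suc_eq_le)
      then show ?thesis
        using less.IH[of m] Suc v' by simp
    qed
    have "(t - u - v) + (u + v) \<in> K"
      by (rule K.add_closed[OF subsetD[OF K.U_rel_subset v(2)] K.add_closed[OF u(2) vK]])
    then show ?case
      by simp
  qed
  show ?thesis
  proof
    fix t assume "t \<in> K'"
    \<comment> \<open>A crude bound on the order: the sum of the lengths of all words that
      occur.\<close>
    moreover have "t \<in> tensor_filtration (\<Sum>w\<in>keys t. length (letters w))"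
      unfolding tensor_filtration_def by (auto intro: member_le_sum)
    ultimately show "t \<in> K"
      using main by blast
  qed
qed

section \<open>Transfer to ideals of the enveloping algebra\<close>

definition U_preimage :: "'k::field_char_0 witt_tensor set set \<Rightarrow> 'k witt_tensor set" where
  "U_preimage J = {t. U_class t \<in> J}"

lemma tensor_ideal_U_preimage:
  assumes "ideal J U_W"
  shows "tensor_ideal (U_preimage J)"
proof
  have sub: "additive_subgroup J U_W"
    using assms by (simp add: ideal_def)
  show "U_rel \<subseteq> U_preimage J"
  proof
    fix t assume "t \<in> (U_rel :: 'a witt_tensor set)"
    then have "U_class t = \<zero>\<^bsub>U_W\<^esub>"
      by (simp add: U_class_zero U_class_eq_iff)
    then show "t \<in> U_preimage J"
      using additive_subgroup.zero_closed[OF sub] by (simp add: U_preimage_def)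
  qed
  show "x + y \<in> U_preimage J" if "x \<in> U_preimage J" "y \<in> U_preimage J" for x y
    using additive_subgroup.a_closed[OF sub, of "U_class x" "U_class y"] that
    by (simp add: U_preimage_def U_class_add)
  show "a * x \<in> U_preimage J" "x * a \<in> U_preimage J" if "x \<in> U_preimage J" for a x
    using ideal.I_l_closed[OF assms, of "U_class x" "U_class a"]
      ideal.I_r_closed[OF assms, of "U_class x" "U_class a"] that
    by (simp_all add: U_preimage_def U_class_mult carrier_U_W)
qed

lemma U_class_preimage:
  assumes "ideal J U_W"
  shows "J = U_class ` U_preimage J"
proof -
  have "J \<subseteq> carrier U_W"
    using assms by (simp add: ideal_def additive_subgroup.a_subset)
  then show ?thesis
    unfolding U_preimage_def carrier_U_W by blast
qed

lemma U_order_class: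
  assumes "t \<in> tensor_filtration n"
  shows "U_order (U_class t) \<le> n"
    and "\<exists>u\<in>tensor_filtration (U_order (U_class t)). U_class t = U_class u"
proof -
  have *: "U_class t \<in> order_filtration n"
    using assms by (simp add: order_filtration_def)
  then show "U_order (U_class t) \<le> n"
    unfolding U_order_def by (rule Least_le)
  have "U_class t \<in> order_filtration (U_order (U_class t))"
    unfolding U_order_def using * by (rule LeastI)
  then show "\<exists>u\<in>tensor_filtration (U_order (U_class t)). U_class t = U_class u"
    unfolding order_filtration_def by blast
qed

text \<open>If the order were below \<open>n\<close>, a shorter representative \<open>u\<close>
  would differ from \<open>t\<close> by an element of \<open>U_rel\<close>, and
  \<open>sym_component_U_rel\<close> would make the symbol of \<open>t\<close> in degree
  \<open>n\<close> vanish.\<close>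

lemma leading_symbolI:
  assumes t: "t \<in> tensor_filtration n" and nz: "sym_component n t \<noteq> 0"
  shows "leading_symbol (U_class t) (sym_component n t)"
proof -
  obtain u where u: "u \<in> tensor_filtration (U_order (U_class t))" "U_class t = U_class u"
    using U_order_class(2)[OF t] by blast
  have "U_order (U_class t) = n"
  proof (rule ccontr)
    assume "U_order (U_class t) \<noteq> n"
    then have less: "U_order (U_class t) < n"
      using U_order_class(1)[OF t] by simp
    have "t - u \<in> U_rel"
      using u(2) by (simp only: U_class_eq_iff)
    moreover have "t - u \<in> tensor_filtration n"
      using less by (intro tensor_filtration_diff t tensor_filtration_mono[OF u(1)]) simp
    ultimately have "sym_component n (t - u) = 0"
      by (rule sym_component_U_rel)
    then show False
      using nz sym_component_filtration_less[OF u(1) less] by (simp add: sym_component_diff)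
  qed
  moreover have "U_class t \<noteq> \<zero>\<^bsub>U_W\<^esub>"
    using nz sym_component_U_rel[of t n] t by (auto simp: U_class_zero U_class_eq_iff)
  ultimately show ?thesis
    using t unfolding leading_symbol_def by blast
qed

text \<open>The generating sets of the two ideals differ at most by zero, since a nonzero element of
  \<open>symbols n\<close> is a leading symbol by \<open>leading_symbolI\<close>.\<close>

lemma gr_o_eq_graded:
  assumes "ideal J U_W"
  shows "gr_o J = tensor_ideal.graded (U_preimage J)"
proof -
  interpret tensor_ideal "U_preimage J"
    by (rule tensor_ideal_U_preimage[OF assms])
  let ?L = "{s. \<exists>u\<in>J. leading_symbol u s}"
  note Idl = genideal_ring_of_type_algebra
  have gr_o: "?L \<subseteq> gr_o J" "ideal (gr_o J) ring_of_type_algebra"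
    unfolding gr_o_def S_W_def by (rule Idl)+
  have "?L \<subseteq> graded"
  proof
    fix s assume "s \<in> ?L"
    then obtain t n where t: "U_class t \<in> J" "t \<in> tensor_filtration n" "s = sym_component n t"
      unfolding leading_symbol_def by auto
    then have "t \<in> U_preimage J"
      by (simp add: U_preimage_def)
    with t have "s \<in> symbols n"
      unfolding symbols_def by blast
    then show "s \<in> graded"
      using symbols_subset_graded by blast
  qed
  then have 1: "gr_o J \<subseteq> graded"
    unfolding gr_o_def S_W_def graded_def by (intro Idl(3) Idl(2))
  have "s \<in> gr_o J" if s: "s \<in> symbols n" for s n
  proof (cases "s = 0")
    case True
    then show ?thesis
      using gr_o(2) unfolding ideal_ring_of_type_algebra_iff by simp
  next
    case False
    obtain t where "t \<in> tensor_filtration n" "t \<in> U_preimage J" "s = sym_component n t"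
      using s unfolding symbols_def by blast
    moreover from this have "U_class t \<in> J"
      by (simp add: U_preimage_def)
    ultimately show ?thesis
      using leading_symbolI[of t n] False gr_o(1) by blast
  qed
  then have "graded \<subseteq> gr_o J"
    unfolding graded_def by (intro Idl(3) gr_o(2)) blast
  with 1 show ?thesis
    by blast
qed

section \<open>The symmetric algebra as a ring of differential polynomials\<close>

interpretation ad_e1: derivation ad_e1
  by unfold_locales (simp_all add: ad_e1_def sym_deriv_add sym_deriv_mult)

text \<open>The index is shifted by one: \<open>y n\<close> is the generator with index
  \<open>n + 1\<close>, so that \<open>y 0\<close> is the constant \<open>gen num.One\<close> and
  the factor \<open>numeral i - 1\<close> in \<open>ad_e1\<close> becomes \<open>n\<close>.\<close>

interpretation ad_e1: differential_polynomials ad_e1 "range const" "\<lambda>n. gen (num_of_nat (Suc n))"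
proof
  show "1 \<in> range const"
    by (metis single_one rangeI)
  show "- c \<in> range const" if "c \<in> range const" for c :: "'a witt_sym"
    using that by (auto simp flip: single_uminus)
  show "c + d \<in> range const" "c * d \<in> range const" if "c \<in> range const" "d \<in> range const" for c d :: "'a witt_sym"
    using that by (auto simp flip: single_add simp: mult_single)
  show "\<exists>d\<in>range const. c * d = 1" if c: "c \<in> range const" "c \<noteq> 0" for c :: "'a witt_sym"
  proof -
    obtain a where a: "c = const a"
      using c by blast
    then have "a \<noteq> 0"
      using c(2) by auto
    then have "c * const (inverse a) = 1"
      by (simp add: a mult_single)
    then show ?thesis by blast
  qed
  show "of_nat (Suc n) \<noteq> (0 :: 'a witt_sym)" for n
    by (metis of_nat_neq_0 of_nat_single single_zero lookup_single_eq lookup_zero)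
  show "ad_e1 c = 0" if "c \<in> range const" for c :: "'a witt_sym"
    using that by (auto simp: ad_e1_def)
  show "ad_e1 (gen (num_of_nat (Suc n))) = (of_nat n * gen (num_of_nat (Suc (Suc n))) :: 'a witt_sym)" for n
  proof -
    have 1: "num.One + num_of_nat (Suc n) = num_of_nat (Suc (Suc n))"
      using num_of_nat_plus_distrib[of 1 "Suc n"] by simp
    have 2: "numeral (num_of_nat (Suc n)) - 1 = (of_nat n :: 'a)"
    proof -
      have "numeral (num_of_nat (Suc n)) = (of_nat (Suc n) :: 'a)"
        by (metis of_nat_numeral nat_of_num_numeral num_of_nat_inverse zero_less_Suc)
      then show ?thesis
        by (simp only: of_nat_Suc add_diff_cancel_left')
    qed
    have "ad_e1 (gen (num_of_nat (Suc n)) :: 'a witt_sym) = single (single (num_of_nat (Suc (Suc n))) 1) (of_nat n)"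
      unfolding ad_e1_def sym_deriv_e 1 2 ..
    also have "\<dots> = const (of_nat n) * gen (num_of_nat (Suc (Suc n)))"
      by (rule single_eq_const_mult)
    finally show ?thesis
      unfolding single_of_nat .
  qed
  show "x \<in> A" if "range const \<subseteq> A" "\<And>n. gen (num_of_nat (Suc n)) \<in> A"
    "\<And>a b. a \<in> A \<Longrightarrow> b \<in> A \<Longrightarrow> a + b \<in> A" "\<And>a b. a \<in> A \<Longrightarrow> b \<in> A \<Longrightarrow> a * b \<in> A"
    for A and x :: "'a witt_sym"
  proof (induction x rule: sym_induct)
    case (gen i)
    show ?case
      using that(2)[of "nat_of_num i - 1"] nat_of_num_pos[of i] by (simp add: nat_of_num_inverse)
  qed (use that in blast)+
qed

theorem corollary2p17:
  fixes J :: "nat \<Rightarrow> 'k::field_char_0 witt_tensor set set"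
  assumes ideals: "\<And>i. ideal (J i) U_W"
    and ascending: "\<And>i. J i \<subseteq> J (Suc i)"
    and radical: "\<And>i. radical_ideal (gr_o (J i)) S_W"
  shows "\<exists>N. \<forall>i\<ge>N. J i = J (Suc i)"
proof -
  have rdi: "ad_e1.rdi (gr_o (J i))" for i
  proof -
    interpret tensor_ideal "U_preimage (J i)"
      by (rule tensor_ideal_U_preimage[OF ideals])
    have "ideal (gr_o (J i)) (ring_of_type_algebra :: 'k witt_sym ring)"
      using radical[of i] by (simp add: radical_ideal_def S_W_def)
    moreover have "x \<in> gr_o (J i)" if "x * x \<in> gr_o (J i)" for x
    proof -
      interpret S: cring "S_W :: 'k witt_sym ring"
        by (rule cring_S_W)
      \<comment> \<open>Squares suffice for \<open>rdi\<close>, so the radical is used with exponent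
        2 only.\<close>
      have "x [^]\<^bsub>S_W\<^esub> (2::nat) = x * x"
        by (simp add: numeral_2_eq_2 S_W_def)
      then have "x \<in> ideal_radical S_W (gr_o (J i))"
        using that by (auto simp: ideal_radical_def S_W_def intro!: exI[of _ 2])
      then show ?thesis
        using radical[of i] by (simp add: radical_ideal_def)
    qed
    moreover have "ad_e1 x \<in> gr_o (J i)" if "x \<in> gr_o (J i)" for x
      using ad_e1_graded[of x] that by (simp add: gr_o_eq_graded[OF ideals])
    ultimately show ?thesis
      unfolding ideal_ring_of_type_algebra_iff by (intro ad_e1.rdiI) blast+
  qed
  have inc: "gr_o (J i) \<subseteq> gr_o (J (Suc i))" for i
    unfolding gr_o_def using ascending[of i]
    by (intro ring.subset_Idl_subset cring.axioms(1) cring_S_W) (auto simp: S_W_def)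
  obtain N where N: "gr_o (J i) = gr_o (J (Suc i))" if "i \<ge> N" for i
    using ad_e1.rdi_ascending_chain[where J = "\<lambda>i. gr_o (J i)", OF ad_e1.Ritt_Raudenbush rdi inc] by blast
  have "J i = J (Suc i)" if "i \<ge> N" for i
  proof -
    have "U_preimage (J (Suc i)) \<subseteq> U_preimage (J i)"
    proof (rule tensor_ideal_eq)
      show "tensor_ideal.graded (U_preimage (J (Suc i))) \<subseteq> tensor_ideal.graded (U_preimage (J i))"
        using N[OF that] by (simp add: gr_o_eq_graded[OF ideals])
      show "U_preimage (J i) \<subseteq> U_preimage (J (Suc i))"
        using ascending by (auto simp: U_preimage_def)
    qed (rule tensor_ideal_U_preimage[OF ideals])+
    then have "U_class ` U_preimage (J (Suc i)) \<subseteq> U_class ` U_preimage (J i)"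
      by (rule image_mono)
    then have "J (Suc i) \<subseteq> J i"
      unfolding U_class_preimage[OF ideals, symmetric] .
    then show ?thesis
      using ascending[of i] by blast
  qed
  then show ?thesis
    by blast
qed

end
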